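(* For every integer $n>0$, $\mathrm{rank}^+(S(P_{G_n},C_{G_n}))=2^{\Omega(n)}$.
   Context: $G_n=(U,V,E)$ is the bipartite multigraph with $|U|=|V|=n$ in which for every $u\in U$, $v\in V$ there are two parallel edges between $u$ and $v$, one red and one blue; an edge is written $(u,v,c)$ with color $c$. $P_{G_n}$ is the convex hull of the characteristic vectors of all perfect matchings of $G_n$ with an odd number of red edges. Let $\mathcal{L}_{\mathrm{all}}(G_n)$ be the set of labelings $L:U\cup V\to\{0,1\}$ with $|L^{-1}(1)|\equiv n\pmod 2$, and for such $L$ let $E_L:=\{(u,v,c):L(u)=L(v),c=\text{blue}\}\cup\{(u,v,c):L(u)\ne L(v),c=\text{red}\}$. $C_{G_n}$ is the system of linear constraints in $x\in\mathbb{R}^E$: $\sum_{e\in\delta(w)}x_e=1$ for all $w\in U\cup V$; $\sum_{e\in E_L}x_e\ge 1$ for all $L\in\mathcal{L}_{\mathrm{all}}(G_n)$; $x_e\ge 0$ for all $e\in E$ (each of these is satisfied by $P_{G_n}$). For a polytope $P=\mathrm{conv}(x_1,\dots,x_l)$ and valid inequalities $a_j^\top x\le b_j$ ($1\le j\le m$), the slack matrix $S(P,C)$ is the $l\times m$ matrix with entries $b_j-a_j^\top x_i$ (equality constraints contribute zero-slack columns). $\mathrm{rank}^+(S)$ is the non-negative rank: the smallest $r$ such that $S$ is a sum of $r$ rank-one matrices $uv^\top$ with $u,v$ entrywise non-negative. *)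

theory Defs
  imports
    "HOL-Analysis.Analysis"
    "HOL-Analysis.Finite_Function_Topology"
    "HOL-Library.Landau_Symbols"
    "HOL-Library.FuncSet"
    "HOL-Number_Theory.Cong"
begin

section \<open>Slack matrices and non-negative rank\<close>

text \<open>
  The space \<open>\<real>\<^sup>E\<close> is the space of finitely supported functions on the edge type, which carries
  the library's real vector space structure and hence its \<open>convex hull\<close>.
\<close>

definition lin_form :: "('e \<Rightarrow>\<^sub>0 real) \<Rightarrow> ('e \<Rightarrow>\<^sub>0 real) \<Rightarrow> real" where
  "lin_form a x =
     (\<Sum>e\<in>Poly_Mapping.keys a. Poly_Mapping.lookup a e * Poly_Mapping.lookup x e)"

definition char_vec :: "'e set \<Rightarrow> ('e \<Rightarrow>\<^sub>0 real)" where
  "char_vec M = (\<Sum>e\<in>M. Poly_Mapping.single e 1)"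

datatype 'e constraint =
    Le "'e \<Rightarrow>\<^sub>0 real" real  \<comment> \<open>\<open>a\<^sup>T x \<le> b\<close>\<close>
  | Eq "'e \<Rightarrow>\<^sub>0 real" real  \<comment> \<open>\<open>a\<^sup>T x = b\<close>\<close>

abbreviation Ge :: "('e \<Rightarrow>\<^sub>0 real) \<Rightarrow> real \<Rightarrow> 'e constraint" where
  "Ge a b \<equiv> Le (- a) (- b)"

text \<open>
  The matrix \<open>S(P,C)\<close> for \<open>P = convex hull X\<close>: rows are indexed by the points of the finite set \<open>X\<close>,
  columns by the constraints in \<open>C\<close>. An equality satisfied by all of \<open>X\<close> gives a zero column.
\<close>

fun slack :: "('e \<Rightarrow>\<^sub>0 real) \<Rightarrow> 'e constraint \<Rightarrow> real" where
  "slack x (Le a b) = b - lin_form a x"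
| "slack x (Eq a b) = b - lin_form a x"

text \<open>
  Matrices are functions restricted to a finite set \<open>A\<close> of row indices and a finite set \<open>B\<close> of column
  indices. If \<open>A\<close> and \<open>B\<close> are finite and \<open>S\<close> is non-negative on them, a factorization exists,
  so that the minimum is attained. Allowing zero summands does not affect the minimum.
\<close>

definition has_nonneg_factorization ::
  "'r set \<Rightarrow> 'c set \<Rightarrow> ('r \<Rightarrow> 'c \<Rightarrow> real) \<Rightarrow> nat \<Rightarrow> bool" where
  "has_nonneg_factorization A B S r \<longleftrightarrow>
     (\<exists>(u :: nat \<Rightarrow> 'r \<Rightarrow> real) (v :: nat \<Rightarrow> 'c \<Rightarrow> real).
        (\<forall>k<r. (\<forall>i\<in>A. 0 \<le> u k i) \<and> (\<forall>j\<in>B. 0 \<le> v k j)) \<and>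
        (\<forall>i\<in>A. \<forall>j\<in>B. S i j = (\<Sum>k<r. u k i * v k j)))"

definition nonneg_rank :: "'r set \<Rightarrow> 'c set \<Rightarrow> ('r \<Rightarrow> 'c \<Rightarrow> real) \<Rightarrow> nat" where
  "nonneg_rank A B S = (LEAST r. has_nonneg_factorization A B S r)"


section \<open>The red-blue complete bipartite multigraph\<close>

datatype color = Red | Blue

text \<open>\<open>Inl i\<close> and \<open>Inr j\<close> with \<open>i, j < n\<close> are the vertices of \<open>U\<close> and \<open>V\<close>.\<close>

type_synonym vertex = "nat + nat"
type_synonym edge = "vertex \<times> vertex \<times> color"

definition U :: "nat \<Rightarrow> vertex set" where
  "U n = Inl ` {..<n}"

definition V :: "nat \<Rightarrow> vertex set" where
  "V n = Inr ` {..<n}"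

definition edges :: "nat \<Rightarrow> edge set" where
  "edges n = U n \<times> V n \<times> {Red, Blue}"

definition incident :: "nat \<Rightarrow> vertex \<Rightarrow> edge set" where
  "incident n w = {(u, v, c) \<in> edges n. w = u \<or> w = v}"

definition perfect_matching :: "nat \<Rightarrow> edge set \<Rightarrow> bool" where
  "perfect_matching n M \<longleftrightarrow> M \<subseteq> edges n \<and> (\<forall>w \<in> U n \<union> V n. card (M \<inter> incident n w) = 1)"

definition odd_red_polytope :: "nat \<Rightarrow> (edge \<Rightarrow>\<^sub>0 real) set" where
  "odd_red_polytope n =
     convex hull (char_vec ` {M. perfect_matching n M \<and> odd (card {(u, v, c) \<in> M. c = Red})})"

definition labelings :: "nat \<Rightarrow> (vertex \<Rightarrow> nat) set" where
  "labelings n =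
     {L \<in> (U n \<union> V n) \<rightarrow>\<^sub>E {0, 1}. [card {w \<in> U n \<union> V n. L w = 1} = n] (mod 2)}"

definition label_edges :: "nat \<Rightarrow> (vertex \<Rightarrow> nat) \<Rightarrow> edge set" where
  "label_edges n L =
     {(u, v, c) \<in> edges n. L u = L v \<and> c = Blue} \<union> {(u, v, c) \<in> edges n. L u \<noteq> L v \<and> c = Red}"

definition constraint_system :: "nat \<Rightarrow> edge constraint set" where
  "constraint_system n =
     (\<lambda>w. Eq (char_vec (incident n w)) 1) ` (U n \<union> V n) \<union>
     (\<lambda>L. Ge (char_vec (label_edges n L)) 1) ` labelings n \<union>
     (\<lambda>e. Ge (char_vec {e}) 0) ` edges n"

end

theory Submission
  imports Defs "HOL-Combinatorics.Transposition" "HOL-Real_Asymp.Real_Asymp"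
begin

text \<open>
  For a perfect matching \<open>M\<close> with an odd number of red edges and a labeling \<open>L\<close>, the number
  \<open>N = card (M \<inter> E\<^sub>L)\<close> is odd and the slack is \<open>N - 1\<close>. A rank-one term \<open>u(L) v(M)\<close> of a
  non-negative factorization therefore vanishes whenever \<open>N = 1\<close>, and the terms add up to \<open>2\<close> where
  \<open>N = 3\<close> and to \<open>4\<close> where \<open>N = 5\<close>.

  Hide at random places of the graph five edges of \<open>M \<inter> E\<^sub>L\<close>, arranged as the vertices of a pentagon.
  Either of \<open>L\<close> and \<open>M\<close> can be modified so that two adjacent ones leave \<open>M \<inter> E\<^sub>L\<close>. As neither
  can distinguish the modified place from linearly many similar places, a Chernoff bound shows that
  for most random choices the averages of \<open>u\<close> and \<open>v\<close> hardly change under a modification, up to an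
  exponentially small error. Modifying \<open>L\<close> at one side of the pentagon and \<open>M\<close> at a disjoint side
  gives \<open>N = 1\<close>; hence the sides where the modified averages of \<open>u\<close> and \<open>v\<close> are both
  non-zero intersect pairwise, and there are at most two of them among five. So the sum of a
  rank-one term over the five configurations with \<open>N = 3\<close> is essentially at most twice its value for
  \<open>N = 5\<close>. Summing over the terms would give \<open>5 \<cdot> 2 \<le> 2 \<cdot> 4\<close>, so that exponentially many
  terms are needed to make up for the errors.
\<close>

section \<open>Correlation of functions on the cube with coordinates\<close>

text \<open>A point of the cube is given by the set of its coordinates equal to 1. Up to sign this
  is the Walsh character of the single coordinate \<open>j\<close>.\<close>

definition walsh :: "'a \<Rightarrow> 'a set \<Rightarrow> real" where
  "walsh j w = (if j \<in> w then 1 else -1)"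

text \<open>A Hoeffding-type bound for \<open>2 * cosh x\<close>. The exponent is twice the optimal
  one; in return, quadratic bounds on \<open>exp\<close> suffice.\<close>

lemma exp_plus_exp_minus_le:
  fixes x :: real
  assumes "0 \<le> x" "x \<le> 1"
  shows "exp x + exp (- x) \<le> 2 * exp (x\<^sup>2)"
proof -
  have "exp x \<le> 1 + x + x\<^sup>2"
    using exp_bound assms by auto
  moreover have "exp (- x) \<le> 1 - x + x\<^sup>2"
  proof -
    \<comment> \<open>The product is \<open>1 + x^3\<close>.\<close>
    have "1 \<le> (1 - x + x\<^sup>2) * (1 + x)"
      using assms by (simp add: algebra_simps power2_eq_square)
    also have "\<dots> \<le> (1 - x + x\<^sup>2) * exp x"
    proof (intro mult_left_mono exp_ge_add_one_self)
      show "0 \<le> 1 - x + x\<^sup>2" using assms by simp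
    qed
    finally show ?thesis
      by (simp add: exp_minus field_simps)
  qed
  ultimately have "exp x + exp (- x) \<le> 2 * (1 + x\<^sup>2)"
    by simp
  also have "\<dots> \<le> 2 * exp (x\<^sup>2)"
    by (intro mult_left_mono exp_ge_add_one_self) simp
  finally show ?thesis .
qed

text \<open>This is the moment generating function of a signed sum of independent fair signs: the
  sum over the cube factorizes by coordinates, and \<open>s j = -1\<close> merely swaps the two
  summands of its factor.\<close>

lemma sum_Pow_exp_walsh:
  fixes s :: "'a \<Rightarrow> real"
  assumes "finite J" and s: "\<And>j. j \<in> J \<Longrightarrow> s j = 1 \<or> s j = -1"
  shows "(\<Sum>w\<in>Pow J. exp (x * (\<Sum>j\<in>J. s j * walsh j w))) = (exp x + exp (- x)) ^ card J"
proof -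
  have "(exp x + exp (- x)) ^ card J = (\<Prod>j\<in>J. exp (x * s j) + exp (- (x * s j)))"
  proof -
    have "exp (x * s j) + exp (- (x * s j)) = exp x + exp (- x)" if "j \<in> J" for j
      using s[OF that] by auto
    then show ?thesis by simp
  qed
  also have "\<dots> = (\<Sum>w\<in>Pow J. (\<Prod>j\<in>w. exp (x * s j)) * (\<Prod>j\<in>J - w. exp (- (x * s j))))"
    using assms(1) by (rule prod_add)
  also have "\<dots> = (\<Sum>w\<in>Pow J. exp (x * (\<Sum>j\<in>J. s j * walsh j w)))"
  proof (rule sum.cong)
    fix w assume "w \<in> Pow J"
    then have "w \<subseteq> J" by simp
    have "(\<Prod>j\<in>w. exp (x * s j)) * (\<Prod>j\<in>J - w. exp (- (x * s j)))
        = (\<Prod>j\<in>J - w. exp (x * (s j * walsh j w))) * (\<Prod>j\<in>w. exp (x * (s j * walsh j w)))"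
      by (simp add: walsh_def mult.commute)
    also have "\<dots> = (\<Prod>j\<in>J. exp (x * (s j * walsh j w)))"
      by (rule prod.subset_diff[OF \<open>w \<subseteq> J\<close> assms(1), symmetric])
    also have "\<dots> = exp (x * (\<Sum>j\<in>J. s j * walsh j w))"
      using assms(1) by (simp add: exp_sum sum_distrib_left)
    finally show "(\<Prod>j\<in>w. exp (x * s j)) * (\<Prod>j\<in>J - w. exp (- (x * s j)))
        = exp (x * (\<Sum>j\<in>J. s j * walsh j w))" .
  qed simp
  finally show ?thesis by simp
qed

text \<open>Bounding the absolute values means bounding \<open>\<Sum>w. \<phi> w * D w\<close> for a signed sum \<open>D\<close> of coordinates,
  and \<open>D w > \<epsilon> * card J\<close> only for an exponentially small fraction of the points, by Chernoff.\<close>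

lemma sum_abs_walsh_le:
  fixes \<phi> :: "'a set \<Rightarrow> real"
  assumes J: "finite J"
    and \<phi>: "\<And>w. w \<subseteq> J \<Longrightarrow> 0 \<le> \<phi> w" "\<And>w. w \<subseteq> J \<Longrightarrow> \<phi> w \<le> C"
    and \<epsilon>: "0 \<le> \<epsilon>" "\<epsilon> \<le> 1"
  shows "(\<Sum>j\<in>J. \<bar>\<Sum>w\<in>Pow J. walsh j w * \<phi> w\<bar>)
    \<le> real (card J) * (\<epsilon> * (\<Sum>w\<in>Pow J. \<phi> w) + C * 2 ^ card J * exp (- (\<epsilon>\<^sup>2 / 4 * card J)))"
proof -
  define s where "s j = (if (\<Sum>w\<in>Pow J. walsh j w * \<phi> w) \<ge> 0 then 1 else -1 :: real)" for j
  define D where "D w = (\<Sum>j\<in>J. s j * walsh j w)" for w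
  define m where "m = real (card J)"
  have s: "s j = 1 \<or> s j = -1" for j
    by (simp add: s_def)
  have "C \<ge> 0"
    using \<phi>[of "{}"] by simp
  have "D w \<le> (\<Sum>j\<in>J. 1)" for w
    unfolding D_def
  proof (rule sum_mono)
    fix j show "s j * walsh j w \<le> 1"
      by (simp add: s_def walsh_def)
  qed
  then have D: "D w \<le> m" for w
    by (simp add: m_def)
  \<comment> \<open>Exponential Markov inequality: where \<open>D w > \<epsilon> * m\<close>, the
    last factor is at least 1 and \<open>D w \<le> m\<close>. The rate
    \<open>x = \<epsilon> / 2\<close> minimizes \<open>x^2 - \<epsilon> * x\<close>, the exponent
    per coordinate after averaging.\<close>
  have pointwise: "D w * \<phi> w \<le> m * (\<epsilon> * \<phi> w + C * exp (\<epsilon> / 2 * (D w - \<epsilon> * m)))" if "w \<subseteq> J" for w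
  proof (cases "D w \<le> \<epsilon> * m")
    case True
    have "D w * \<phi> w \<le> (\<epsilon> * m) * \<phi> w"
      using True \<phi>(1)[OF that] by (rule mult_right_mono)
    moreover have "0 \<le> m * (C * exp (\<epsilon> / 2 * (D w - \<epsilon> * m)))"
      using \<open>C \<ge> 0\<close> by (simp add: m_def)
    ultimately show ?thesis
      by (simp add: algebra_simps)
  next
    case False
    then have "1 \<le> exp (\<epsilon> / 2 * (D w - \<epsilon> * m))"
      using \<epsilon> by simp
    then have "\<phi> w \<le> C * exp (\<epsilon> / 2 * (D w - \<epsilon> * m))"
      using \<phi>(2)[OF that] mult_left_mono[of 1 "exp (\<epsilon> / 2 * (D w - \<epsilon> * m))" C] \<open>C \<ge> 0\<close> by simp
    then have "m * \<phi> w \<le> m * (C * exp (\<epsilon> / 2 * (D w - \<epsilon> * m)))"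
      by (simp add: mult_left_mono m_def)
    moreover have "D w * \<phi> w \<le> m * \<phi> w"
      using D \<phi>(1)[OF that] by (simp add: mult_right_mono)
    moreover have "0 \<le> m * (\<epsilon> * \<phi> w)"
      using \<epsilon> \<phi>(1)[OF that] by (simp add: m_def)
    ultimately show ?thesis
      by (simp add: algebra_simps)
  qed
  have "(\<Sum>j\<in>J. \<bar>\<Sum>w\<in>Pow J. walsh j w * \<phi> w\<bar>) = (\<Sum>j\<in>J. \<Sum>w\<in>Pow J. s j * walsh j w * \<phi> w)"
    by (rule sum.cong) (auto simp: s_def sum_negf)
  also have "\<dots> = (\<Sum>w\<in>Pow J. D w * \<phi> w)"
    by (subst sum.swap) (simp add: D_def sum_distrib_right)
  also have "\<dots> \<le> (\<Sum>w\<in>Pow J. m * (\<epsilon> * \<phi> w + C * exp (\<epsilon> / 2 * (D w - \<epsilon> * m))))"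
    by (rule sum_mono) (use pointwise in auto)
  also have "\<dots> = m * (\<epsilon> * (\<Sum>w\<in>Pow J. \<phi> w)
      + C * (\<Sum>w\<in>Pow J. exp (\<epsilon> / 2 * D w)) * exp (- (\<epsilon>\<^sup>2 / 2 * m)))"
    by (simp add: sum.distrib sum_distrib_left sum_distrib_right algebra_simps power2_eq_square
        flip: exp_add)
  also have "(\<Sum>w\<in>Pow J. exp (\<epsilon> / 2 * D w)) = (exp (\<epsilon> / 2) + exp (- (\<epsilon> / 2))) ^ card J"
    unfolding D_def using J s by (rule sum_Pow_exp_walsh)
  also have "m * (\<epsilon> * (\<Sum>w\<in>Pow J. \<phi> w)
        + C * (exp (\<epsilon> / 2) + exp (- (\<epsilon> / 2))) ^ card J * exp (- (\<epsilon>\<^sup>2 / 2 * m)))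
      \<le> m * (\<epsilon> * (\<Sum>w\<in>Pow J. \<phi> w) + C * (2 * exp ((\<epsilon> / 2)\<^sup>2)) ^ card J * exp (- (\<epsilon>\<^sup>2 / 2 * m)))"
    using exp_plus_exp_minus_le[of "\<epsilon> / 2"] \<epsilon> \<open>C \<ge> 0\<close>
    by (intro mult_left_mono add_left_mono mult_right_mono power_mono) (auto simp: m_def)
  also have "(2 * exp ((\<epsilon> / 2)\<^sup>2)) ^ card J = 2 ^ card J * exp (\<epsilon>\<^sup>2 / 4 * m)"
    by (simp add: power_mult_distrib power_divide m_def mult.commute flip: exp_of_nat_mult)
  also have "C * (2 ^ card J * exp (\<epsilon>\<^sup>2 / 4 * m)) * exp (- (\<epsilon>\<^sup>2 / 2 * m))
      = C * 2 ^ card J * (exp (\<epsilon>\<^sup>2 / 4 * m + - (\<epsilon>\<^sup>2 / 2 * m)))"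
    by (simp only: exp_add mult.assoc)
  also have "\<epsilon>\<^sup>2 / 4 * m + - (\<epsilon>\<^sup>2 / 2 * m) = - (\<epsilon>\<^sup>2 / 4 * m)"
    by (simp add: field_simps)
  finally show ?thesis
    by (simp add: m_def)
qed

text \<open>Permuting the cube by the transposition is a bijection that exchanges the coordinates
  \<open>j\<close> and \<open>m\<close>.\<close>

lemma sum_walsh_transpose:
  fixes \<phi> :: "nat set \<Rightarrow> real"
  assumes "j \<le> m"
  shows "(\<Sum>w\<in>Pow {..m}. walsh m w * \<phi> (Transposition.transpose j m ` w)) = (\<Sum>w\<in>Pow {..m}. walsh j w * \<phi> w)"
proof (rule sum.reindex_bij_witness[where i = "(`) (Transposition.transpose j m)" and j = "(`) (Transposition.transpose j m)"])
  fix w assume "w \<in> Pow {..m}"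
  have image: "Transposition.transpose j m ` w' \<subseteq> {..m}" if "w' \<subseteq> {..m}" for w'
    using that assms by (auto simp: Transposition.transpose_def)
  show "Transposition.transpose j m ` Transposition.transpose j m ` w = w"
    by (simp add: image_image)
  show "Transposition.transpose j m ` w \<in> Pow {..m}"
    using image \<open>w \<in> Pow {..m}\<close> by simp
  have "m \<in> w \<longleftrightarrow> j \<in> Transposition.transpose j m ` w"
    by (auto simp: Transposition.transpose_def image_iff)
  then show "walsh j (Transposition.transpose j m ` w) * \<phi> (Transposition.transpose j m ` w)
      = walsh m w * \<phi> (Transposition.transpose j m ` w)"
    by (simp add: walsh_def)
qed (use assms in \<open>auto simp: image_image Transposition.transpose_def\<close>)

text \<open>The symmetries \<open>T j\<close> make the last coordinate indistinguishable from a random one.\<close>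

lemma sum_abs_last_walsh_le:
  fixes \<phi> :: "'h \<Rightarrow> nat set \<Rightarrow> real"
  assumes \<phi>: "\<And>h w. h \<in> H \<Longrightarrow> w \<subseteq> {..m} \<Longrightarrow> 0 \<le> \<phi> h w"
      "\<And>h w. h \<in> H \<Longrightarrow> w \<subseteq> {..m} \<Longrightarrow> \<phi> h w \<le> C"
    and g: "\<And>h. h \<in> H \<Longrightarrow> 0 \<le> g h"
    and T: "\<And>j h. j < m \<Longrightarrow> h \<in> H \<Longrightarrow> T j h \<in> H"
      "\<And>j h. j < m \<Longrightarrow> h \<in> H \<Longrightarrow> T j (T j h) = h"
      "\<And>j h. j < m \<Longrightarrow> h \<in> H \<Longrightarrow> g (T j h) = g h"
      "\<And>j h w. j < m \<Longrightarrow> h \<in> H \<Longrightarrow> w \<subseteq> {..m} \<Longrightarrow> \<phi> (T j h) w = \<phi> h (Transposition.transpose j m ` w)"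
    and \<epsilon>: "0 \<le> \<epsilon>" "\<epsilon> \<le> 1"
  shows "(\<Sum>h\<in>H. g h * \<bar>\<Sum>w\<in>Pow {..m}. walsh m w * \<phi> h w\<bar>)
    \<le> \<epsilon> * (\<Sum>h\<in>H. g h * (\<Sum>w\<in>Pow {..m}. \<phi> h w))
      + C * 2 ^ Suc m * exp (- (\<epsilon>\<^sup>2 / 4 * Suc m)) * (\<Sum>h\<in>H. g h)"
    (is "?L \<le> ?R")
proof -
  \<comment> \<open>Reindexing \<open>H\<close> by the involution \<open>T j\<close> keeps the
    weight \<open>g\<close> and moves the transposition into \<open>\<phi>\<close>, which turns
    coordinate \<open>m\<close> into \<open>j\<close>.\<close>
  have coord: "?L = (\<Sum>h\<in>H. g h * \<bar>\<Sum>w\<in>Pow {..m}. walsh j w * \<phi> h w\<bar>)" if "j \<le> m" for j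
  proof (cases "j = m")
    case False
    with that have "j < m" by simp
    have "?L = (\<Sum>h\<in>H. g (T j h) * \<bar>\<Sum>w\<in>Pow {..m}. walsh m w * \<phi> (T j h) w\<bar>)"
      by (rule sum.reindex_bij_witness[where i = "T j" and j = "T j"]) (use T \<open>j < m\<close> in auto)
    also have "\<dots> = (\<Sum>h\<in>H. g h * \<bar>\<Sum>w\<in>Pow {..m}. walsh m w * \<phi> h (Transposition.transpose j m ` w)\<bar>)"
      by (rule sum.cong) (use T(3,4) \<open>j < m\<close> in auto)
    finally show ?thesis
      by (simp only: sum_walsh_transpose[OF that])
  qed simp
  \<comment> \<open>All \<open>m + 1\<close> coordinates yield the same sum, so the bound on the sum
    over coordinates applies after multiplying by their number.\<close>
  have "real (Suc m) * ?L = (\<Sum>j\<le>m. ?L)"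
    by simp
  also have "\<dots> = (\<Sum>j\<le>m. \<Sum>h\<in>H. g h * \<bar>\<Sum>w\<in>Pow {..m}. walsh j w * \<phi> h w\<bar>)"
    by (rule sum.cong) (use coord in auto)
  also have "\<dots> = (\<Sum>h\<in>H. g h * (\<Sum>j\<le>m. \<bar>\<Sum>w\<in>Pow {..m}. walsh j w * \<phi> h w\<bar>))"
    by (subst sum.swap) (simp add: sum_distrib_left)
  also have "\<dots> \<le> (\<Sum>h\<in>H. g h * (real (Suc m) * (\<epsilon> * (\<Sum>w\<in>Pow {..m}. \<phi> h w)
      + C * 2 ^ Suc m * exp (- (\<epsilon>\<^sup>2 / 4 * Suc m)))))"
  proof (intro sum_mono mult_left_mono)
    fix h assume "h \<in> H"
    then show "(\<Sum>j\<le>m. \<bar>\<Sum>w\<in>Pow {..m}. walsh j w * \<phi> h w\<bar>)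
        \<le> real (Suc m) * (\<epsilon> * (\<Sum>w\<in>Pow {..m}. \<phi> h w) + C * 2 ^ Suc m * exp (- (\<epsilon>\<^sup>2 / 4 * Suc m)))"
      using sum_abs_walsh_le[of "{..m}" "\<phi> h" C \<epsilon>] \<phi> \<epsilon> by simp
  qed (use g in auto)
  also have "\<dots> = real (Suc m) * ?R"
    by (simp only: sum_distrib_left sum_distrib_right sum.distrib distrib_left mult.assoc
        mult.left_commute mult.commute)
  finally show ?thesis
    using mult_le_cancel_left_pos[of "real (Suc m)"] by simp
qed

section \<open>Placed labelings and matchings\<close>

text \<open>
  The vertices on either side are placed at random on the following positions; unless stated
  otherwise, the vertices of \<open>U\<close> and \<open>V\<close> at the same position are matched.
  \<^item> \<open>Zone k\<close> for \<open>k < 5\<close> is an edge that lies in \<open>E\<^sub>L\<close> in the initial configuration, given by the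
    argument \<open>None\<close> below. The pairs \<open>{i, nxt i}\<close> form a pentagon. The labeling (argument
    \<open>c = Some i\<close>) and, independently, the matching (argument \<open>e = Some i\<close>) may each remove the edges
    at \<open>i\<close> and \<open>nxt i\<close> from \<open>M \<inter> E\<^sub>L\<close>: the former by flipping one endpoint of each, the latter by
    crossing the two edges and making them red.
  \<^item> \<open>Spare\<close> corrects the parity of \<open>n\<close>.
  \<^item> \<open>Alice j\<close> is a red edge both of whose endpoints carry the label \<open>j \<in> z\<close>.
  \<^item> \<open>Bob j True\<close> and \<open>Bob j False\<close> are two edges with fixed labels, which the matching crosses
    if \<open>j \<in> t\<close>.
  The labels and the matching are chosen so that, with \<open>Some i\<close> fixed on the other side, the edge from
  \<open>Zone i\<close> to \<open>Zone (nxt i)\<close> looks like one of the \<open>Alice j\<close>, and the zone pair \<open>{i, nxt i}\<close> like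
  one of the pairs \<open>Bob j\<close>.
\<close>

datatype pos = Zone nat | Spare | Alice nat | Bob nat bool

definition positions :: "nat \<Rightarrow> nat \<Rightarrow> pos set" where
  "positions p q =
     Zone ` {..<5} \<union> {Spare} \<union> Alice ` {..<p} \<union> (\<lambda>(j, b). Bob j b) ` ({..<q} \<times> UNIV)"

definition nxt :: "nat \<Rightarrow> nat" where
  "nxt i = Suc i mod 5"

primrec left_label :: "bool \<Rightarrow> nat option \<Rightarrow> nat set \<Rightarrow> pos \<Rightarrow> bool" where
  "left_label s c z (Zone k) = (c = Some k)"
| "left_label s c z Spare = s"
| "left_label s c z (Alice j) = (j \<in> z)"
| "left_label s c z (Bob j b) = b"

primrec right_label :: "nat option \<Rightarrow> nat set \<Rightarrow> pos \<Rightarrow> bool" where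
  "right_label c z (Zone k) = (map_option nxt c = Some k)"
| "right_label c z Spare = False"
| "right_label c z (Alice j) = (j \<in> z)"
| "right_label c z (Bob j b) = (\<not> b)"

primrec partner :: "nat option \<Rightarrow> nat set \<Rightarrow> pos \<Rightarrow> pos" where
  "partner e t (Zone k) =
     Zone (case e of None \<Rightarrow> k | Some i \<Rightarrow> Transposition.transpose i (nxt i) k)"
| "partner e t Spare = Spare"
| "partner e t (Alice j) = Alice j"
| "partner e t (Bob j b) = Bob j (b \<noteq> (j \<in> t))"

primrec blue :: "bool \<Rightarrow> nat option \<Rightarrow> nat set \<Rightarrow> pos \<Rightarrow> bool" where
  "blue s e t (Zone k) = (e \<noteq> Some k \<and> map_option nxt e \<noteq> Some k)"
| "blue s e t Spare = s"
| "blue s e t (Alice j) = False"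
| "blue s e t (Bob j b) = (j \<notin> t)"

section \<open>Counting over positions, and the pentagon\<close>

lemma finite_positions: "finite (positions p q)"
  by (simp add: positions_def)

lemma sum_positions:
  fixes f :: "pos \<Rightarrow> 'a::comm_monoid_add"
  shows "sum f (positions p q) = (\<Sum>k<5. f (Zone k)) + f Spare + (\<Sum>j<p. f (Alice j))
    + (\<Sum>j<q. f (Bob j True) + f (Bob j False))"
proof -
  have "sum f ((\<lambda>(j, b). Bob j b) ` ({..<q} \<times> UNIV)) = (\<Sum>(j, b)\<in>{..<q} \<times> UNIV. f (Bob j b))"
    by (subst sum.reindex) (auto simp: inj_on_def case_prod_beta)
  also have "\<dots> = (\<Sum>j<q. f (Bob j True) + f (Bob j False))"
    by (simp add: UNIV_bool add.commute flip: sum.cartesian_product)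
  finally have bob: "sum f ((\<lambda>(j, b). Bob j b) ` ({..<q} \<times> UNIV))
    = (\<Sum>j<q. f (Bob j True) + f (Bob j False))" .
  have disj: "Zone ` {..<5} \<inter> {Spare} = {}" "(Zone ` {..<5} \<union> {Spare}) \<inter> Alice ` {..<p} = {}"
    "(Zone ` {..<5} \<union> {Spare} \<union> Alice ` {..<p}) \<inter> (\<lambda>(j, b). Bob j b) ` ({..<q} \<times> UNIV) = {}"
    by auto
  show ?thesis
    unfolding positions_def
    by (simp add: sum.union_disjoint[OF _ _ disj(1)] sum.union_disjoint[OF _ _ disj(2)]
        sum.union_disjoint[OF _ _ disj(3)] bob sum.reindex inj_on_def del: Un_insert_right)
qed

lemma card_positions: "card (positions p q) = 6 + p + 2 * q"
  using sum_positions[of "\<lambda>_. 1::nat" p q] by simp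

lemma less_5_cases: "k < 5 \<Longrightarrow> k = 0 \<or> k = 1 \<or> k = 2 \<or> k = 3 \<or> k = (4::nat)"
  by auto

lemma nxt_simps: "nxt 0 = 1" "nxt (Suc 0) = 2" "nxt 2 = 3" "nxt 3 = 4" "nxt 4 = 0"
  by (simp_all add: nxt_def)

lemma nxt_less: "nxt i < 5"
  by (simp add: nxt_def)

lemma nxt_neq: "i < 5 \<Longrightarrow> nxt i \<noteq> i" "i < 5 \<Longrightarrow> i \<noteq> nxt i"
  by (auto dest!: less_5_cases simp: nxt_simps)

lemma sum_less_5: "(\<Sum>k<5. f k) = f 0 + f 1 + f 2 + f 3 + f (4::nat)"
  by (simp add: eval_nat_numeral)

lemma partner_involution: "partner e t (partner e t k) = k"
  by (cases k) (auto split: option.splits)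

lemma partner_in_positions:
  assumes "\<And>i. e = Some i \<Longrightarrow> i < 5" "k \<in> positions p q"
  shows "partner e t k \<in> positions p q"
  using assms
  by (cases k) (auto simp: positions_def image_iff Transposition.transpose_def nxt_less split: option.splits)

lemma bij_betw_partner:
  assumes "\<And>i. e = Some i \<Longrightarrow> i < 5"
  shows "bij_betw (partner e t) (positions p q) (positions p q)"
  by (rule bij_betw_byWitness[where f' = "partner e t"])
    (use assms partner_in_positions in \<open>auto simp: partner_involution\<close>)

section \<open>Zone edges that remain in \<open>M \<inter> E\<^sub>L\<close>\<close>

definition violations :: "nat option \<Rightarrow> nat option \<Rightarrow> nat set" where
  "violations c e = {k. k < 5 \<and>
     (((c = Some k) \<noteq> right_label c {} (partner e {} (Zone k))) \<noteq> blue False e {} (Zone k))}"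

text \<open>An edge lies in \<open>E\<^sub>L\<close> iff "its labels differ" and "it is blue" have
  different truth values. An \<open>Alice\<close> edge is red with equal labels; a
  \<open>Bob\<close> edge is blue with different labels, or crossed and red with equal ones; at
  \<open>Spare\<close> both truth values are \<open>s\<close>. So only zones remain, and there
  \<open>s\<close>, \<open>z\<close> and \<open>t\<close> do not enter, hence the default values in
  \<open>violations\<close>.\<close>

lemma violated_positions:
  "{k \<in> positions p q. (left_label s c z k \<noteq> right_label c z (partner e t k)) \<noteq> blue s e t k}
     = Zone ` violations c e"
proof -
  have "k \<in> {k \<in> positions p q.
      (left_label s c z k \<noteq> right_label c z (partner e t k)) \<noteq> blue s e t k}
      \<longleftrightarrow> k \<in> Zone ` violations c e" for k
    by (cases k) (auto simp: positions_def violations_def image_iff)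
  then show ?thesis by blast
qed

lemma in_violations_iff:
  "k \<in> violations c e \<longleftrightarrow> k < 5 \<and>
     (((c = Some k) \<noteq> right_label c {} (partner e {} (Zone k))) \<noteq> blue False e {} (Zone k))"
  by (simp add: violations_def)

lemma card_violations:
  "card (violations c e) = (\<Sum>k<5. of_bool (k \<in> violations c e))"
proof -
  have "violations c e = {..<5} \<inter> {k. k \<in> violations c e}"
    by (auto simp: violations_def)
  then show ?thesis
    by (simp add: of_bool_def sum.If_cases)
qed

text \<open>The slacks 4 and 2 of the counting argument, increased by 1. Both modifications at the
  same \<open>i\<close> remove the same two edges as either alone: the crossed edges are red, and
  their labels are 1, 1 and 0, 0.\<close>

lemma card_violations_simps:
  "card (violations None None) = 5"
  "i < 5 \<Longrightarrow> card (violations (Some i) None) = 3"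
  "i < 5 \<Longrightarrow> card (violations None (Some i)) = 3"
  "i < 5 \<Longrightarrow> card (violations (Some i) (Some i)) = 3"
proof -
  note simps = card_violations sum_less_5 in_violations_iff nxt_simps Transposition.transpose_def
  show "card (violations None None) = 5"
    by (simp add: simps)
  assume "i < 5"
  note cases = less_5_cases[OF this]
  show "card (violations (Some i) None) = 3"
    using cases by (elim disjE) (simp_all add: simps)
  show "card (violations None (Some i)) = 3"
    using cases by (elim disjE) (simp_all add: simps)
  show "card (violations (Some i) (Some i)) = 3"
    using cases by (elim disjE) (simp_all add: simps)
qed

text \<open>Disjoint sides of the pentagon remove four different edges of the five.\<close>

lemma card_violations_disjoint:
  assumes "i < 5" "j < 5" "{i, nxt i} \<inter> {j, nxt j} = {}"
  shows "card (violations (Some i) (Some j)) = 1"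
  using less_5_cases[OF assms(1)] less_5_cases[OF assms(2)] assms(3)
  by (elim disjE) (simp_all add: card_violations sum_less_5 in_violations_iff nxt_simps
      Transposition.transpose_def)

section \<open>Labelings and matchings obtained by placing the vertices on positions\<close>

definition placements :: "nat \<Rightarrow> 'a set \<Rightarrow> (nat \<Rightarrow> 'a) set" where
  "placements n P = {\<rho> \<in> {..<n} \<rightarrow>\<^sub>E P. bij_betw \<rho> {..<n} P}"

definition labeling :: "nat \<Rightarrow> (nat \<Rightarrow> 'a) \<Rightarrow> (nat \<Rightarrow> 'a) \<Rightarrow> ('a \<Rightarrow> bool) \<Rightarrow> ('a \<Rightarrow> bool) \<Rightarrow> vertex \<Rightarrow> nat"
  where "labeling n \<rho> \<sigma> a b =
    (\<lambda>w\<in>U n \<union> V n. case w of Inl i \<Rightarrow> of_bool (a (\<rho> i)) | Inr j \<Rightarrow> of_bool (b (\<sigma> j)))"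

text \<open>\<open>\<pi>\<close> leads from the position of the endpoint in \<open>U\<close> to that
  of its partner in \<open>V\<close>, and \<open>d\<close> marks the blue edges by the former. The
  type of positions is left open because an explicit matching with positions in \<open>nat\<close>
  is built later.\<close>

definition matching :: "nat \<Rightarrow> (nat \<Rightarrow> 'a) \<Rightarrow> (nat \<Rightarrow> 'a) \<Rightarrow> ('a \<Rightarrow> 'a) \<Rightarrow> ('a \<Rightarrow> bool) \<Rightarrow> edge set"
  where "matching n \<rho> \<sigma> \<pi> d =
    {(Inl i, Inr j, if d (\<rho> i) then Blue else Red) | i j. i < n \<and> j < n \<and> \<sigma> j = \<pi> (\<rho> i)}"

lemma finite_placements: "finite P \<Longrightarrow> finite (placements n P)"
  unfolding placements_def by (rule finite_subset[OF _ finite_PiE[of "{..<n}" "\<lambda>_. P"]]) auto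

lemma placements_nonempty:
  assumes "finite P" "card P = n"
  shows "placements n P \<noteq> {}"
proof -
  obtain \<rho> where "bij_betw \<rho> {..<n} P"
    using assms ex_bij_betw_nat_finite[of P] by (auto simp: lessThan_atLeast0)
  moreover have "bij_betw (restrict \<rho> {..<n}) {..<n} P = bij_betw \<rho> {..<n} P"
    by (rule bij_betw_cong) simp
  ultimately have "restrict \<rho> {..<n} \<in> placements n P"
    by (auto simp: placements_def bij_betw_apply)
  then show ?thesis by blast
qed

lemma sum_of_bool_bij:
  fixes n :: nat
  assumes "bij_betw \<rho> {..<n} P"
  shows "card {i. i < n \<and> f (\<rho> i)} = (\<Sum>k\<in>P. of_bool (f k))"
proof -
  have "(\<Sum>k\<in>P. of_bool (f k)) = (\<Sum>i<n. of_bool (f (\<rho> i)) :: nat)"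
    by (rule sum.reindex_bij_betw[OF assms, symmetric])
  also have "\<dots> = card ({..<n} \<inter> {i. f (\<rho> i)})"
    by simp
  also have "{..<n} \<inter> {i. f (\<rho> i)} = {i. i < n \<and> f (\<rho> i)}"
    by auto
  finally show ?thesis by simp
qed

lemma cong_mod2_iff: "[k = n] (mod 2) \<longleftrightarrow> even (k + n)" for k n :: nat
  unfolding cong_def by presburger

lemma labeling_in_labelings:
  assumes \<rho>: "bij_betw \<rho> {..<n} P" and \<sigma>: "bij_betw \<sigma> {..<n} P"
    and parity: "even ((\<Sum>k\<in>P. of_bool (a k) + of_bool (b k)) + n)"
  shows "labeling n \<rho> \<sigma> a b \<in> labelings n"
proof -
  have "{w \<in> U n \<union> V n. labeling n \<rho> \<sigma> a b w = 1}
      = Inl ` {i. i < n \<and> a (\<rho> i)} \<union> Inr ` {j. j < n \<and> b (\<sigma> j)}"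
    by (auto simp: labeling_def U_def V_def of_bool_def image_iff split: if_splits)
  also have "card \<dots> = card {i. i < n \<and> a (\<rho> i)} + card {j. j < n \<and> b (\<sigma> j)}"
    by (subst card_Un_disjoint) (auto simp: card_image)
  also have "\<dots> = (\<Sum>k\<in>P. of_bool (a k) + of_bool (b k))"
    by (simp only: sum_of_bool_bij[OF \<rho>] sum_of_bool_bij[OF \<sigma>] sum.distrib)
  finally have "even (card {w \<in> U n \<union> V n. labeling n \<rho> \<sigma> a b w = 1} + n)"
    using parity by simp
  then have "[card {w \<in> U n \<union> V n. labeling n \<rho> \<sigma> a b w = 1} = n] (mod 2)"
    by (simp only: cong_mod2_iff)
  moreover have "labeling n \<rho> \<sigma> a b \<in> (U n \<union> V n) \<rightarrow>\<^sub>E {0, 1}"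
    by (auto simp: labeling_def PiE_def Pi_def extensional_def split: sum.splits)
  ultimately show ?thesis
    by (simp add: labelings_def)
qed

lemma perfect_matching_matching:
  assumes \<rho>: "bij_betw \<rho> {..<n} P" and \<sigma>: "bij_betw \<sigma> {..<n} P" and \<pi>: "bij_betw \<pi> P P"
  shows "perfect_matching n (matching n \<rho> \<sigma> \<pi> d)"
proof -
  let ?M = "matching n \<rho> \<sigma> \<pi> d"
  have sub: "?M \<subseteq> edges n"
    by (auto simp: matching_def edges_def U_def V_def)
  have "card (?M \<inter> incident n (Inl i)) = 1" if "i < n" for i
  proof -
    have "\<pi> (\<rho> i) \<in> P"
      using that \<rho> \<pi> by (auto simp: bij_betw_apply)
    then obtain j where j: "j < n" "\<sigma> j = \<pi> (\<rho> i)"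
      using \<sigma> unfolding bij_betw_def by (metis imageE lessThan_iff)
    have "\<sigma> j' = \<pi> (\<rho> i) \<longleftrightarrow> j' = j" if "j' < n" for j'
      using inj_on_eq_iff[OF bij_betw_imp_inj_on[OF \<sigma>], of j' j] that j by simp
    then have "?M \<inter> incident n (Inl i) = {(Inl i, Inr j, if d (\<rho> i) then Blue else Red)}"
      using j \<open>i < n\<close> by (auto simp: matching_def incident_def edges_def U_def V_def)
    then show ?thesis by simp
  qed
  moreover have "card (?M \<inter> incident n (Inr j)) = 1" if "j < n" for j
  proof -
    have bij: "bij_betw (\<lambda>i. \<pi> (\<rho> i)) {..<n} P"
      using bij_betw_trans[OF \<rho> \<pi>] by (simp add: o_def)
    have "\<sigma> j \<in> P"
      using that \<sigma> by (auto simp: bij_betw_apply)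
    then obtain i where i: "i < n" "\<pi> (\<rho> i) = \<sigma> j"
      using bij unfolding bij_betw_def by (metis (no_types, lifting) imageE lessThan_iff)
    have "\<sigma> j = \<pi> (\<rho> i') \<longleftrightarrow> i' = i" if "i' < n" for i'
      using inj_on_eq_iff[OF bij_betw_imp_inj_on[OF bij], of i' i] that i by auto
    then have "?M \<inter> incident n (Inr j) = {(Inl i, Inr j, if d (\<rho> i) then Blue else Red)}"
      using i \<open>j < n\<close> by (auto simp: matching_def incident_def edges_def U_def V_def)
    then show ?thesis by simp
  qed
  ultimately show ?thesis
    using sub by (auto simp: perfect_matching_def U_def V_def)
qed

text \<open>The position of the endpoint in \<open>U\<close> gives a bijection between the edges of
  the matching and \<open>P\<close>. Both the red edges and those in \<open>E\<^sub>L\<close> are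
  counted this way.\<close>

lemma card_filter_matching:
  assumes \<rho>: "bij_betw \<rho> {..<n} P" and \<sigma>: "bij_betw \<sigma> {..<n} P" and \<pi>: "bij_betw \<pi> P P"
    and Q: "\<And>i j. i < n \<Longrightarrow> j < n \<Longrightarrow> \<sigma> j = \<pi> (\<rho> i)
      \<Longrightarrow> Q (Inl i, Inr j, if d (\<rho> i) then Blue else Red) \<longleftrightarrow> R (\<rho> i)"
  shows "card {e \<in> matching n \<rho> \<sigma> \<pi> d. Q e} = card {k \<in> P. R k}"
proof -
  define f where
    "f k = (Inl (inv_into {..<n} \<rho> k) :: vertex, Inr (inv_into {..<n} \<sigma> (\<pi> k)) :: vertex,
       if d k then Blue else Red)" for k
  have r: "inv_into {..<n} \<rho> k < n" "\<rho> (inv_into {..<n} \<rho> k) = k" if "k \<in> P" for k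
    using bij_betw_inv_into_right[OF \<rho> that] bij_betw_apply[OF bij_betw_inv_into[OF \<rho>] that]
    by simp_all
  have s: "inv_into {..<n} \<sigma> k < n" "\<sigma> (inv_into {..<n} \<sigma> k) = k" if "k \<in> P" for k
    using bij_betw_inv_into_right[OF \<sigma> that] bij_betw_apply[OF bij_betw_inv_into[OF \<sigma>] that]
    by simp_all
  have \<pi>P: "\<pi> k \<in> P" if "k \<in> P" for k
    using that \<pi> by (rule bij_betw_apply[rotated])
  have inv: "inv_into {..<n} \<rho> (\<rho> i) = i" "\<rho> i \<in> P" if "i < n" for i
    using bij_betw_inv_into_left[OF \<rho>] bij_betw_apply[OF \<rho>] that by simp_all
  have inv': "inv_into {..<n} \<sigma> (\<sigma> i) = i" if "i < n" for i
    using bij_betw_inv_into_left[OF \<sigma>] that by simp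
  have "{e \<in> matching n \<rho> \<sigma> \<pi> d. Q e} = f ` {k \<in> P. R k}"
  proof (intro equalityI subsetI)
    fix x assume "x \<in> {e \<in> matching n \<rho> \<sigma> \<pi> d. Q e}"
    then obtain i j where ij: "i < n" "j < n" "\<sigma> j = \<pi> (\<rho> i)"
        and x: "x = (Inl i, Inr j, if d (\<rho> i) then Blue else Red)" and "Q x"
      by (auto simp: matching_def)
    then have "R (\<rho> i)" using Q by blast
    moreover have "x = f (\<rho> i)"
      unfolding f_def x inv(1)[OF ij(1)] ij(3)[symmetric] inv'[OF ij(2)] ..
    ultimately show "x \<in> f ` {k \<in> P. R k}"
      using inv(2)[OF ij(1)] by blast
  next
    fix x assume "x \<in> f ` {k \<in> P. R k}"
    then obtain k where k: "k \<in> P" "R k" "x = f k" by blast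
    let ?i = "inv_into {..<n} \<rho> k" and ?j = "inv_into {..<n} \<sigma> (\<pi> k)"
    have "x = (Inl ?i, Inr ?j, if d (\<rho> ?i) then Blue else Red)"
      using k r[OF k(1)] by (simp add: f_def)
    moreover have "\<sigma> ?j = \<pi> (\<rho> ?i)" "?i < n" "?j < n"
      using r[OF k(1)] s[OF \<pi>P[OF k(1)]] by auto
    ultimately show "x \<in> {e \<in> matching n \<rho> \<sigma> \<pi> d. Q e}"
      using Q[of ?i ?j] k(2) r(2)[OF k(1)] by (auto simp: matching_def)
  qed
  moreover have "inj_on f {k \<in> P. R k}"
    by (rule inj_on_inverseI[where g = "\<lambda>(x, y, c). \<rho> (projl x)"]) (use r in \<open>auto simp: f_def\<close>)
  ultimately show ?thesis
    by (simp add: card_image)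
qed

lemma card_red_matching:
  assumes "bij_betw \<rho> {..<n} P" "bij_betw \<sigma> {..<n} P" "bij_betw \<pi> P P"
  shows "card {(u, v, c) \<in> matching n \<rho> \<sigma> \<pi> d. c = Red} = card {k \<in> P. \<not> d k}"
  using card_filter_matching[OF assms, of "\<lambda>(u, v, c). c = Red" d "\<lambda>k. \<not> d k"]
  by (simp add: case_prod_beta')

lemma card_matching_label_edges:
  assumes "bij_betw \<rho> {..<n} P" "bij_betw \<sigma> {..<n} P" "bij_betw \<pi> P P"
  shows "card (matching n \<rho> \<sigma> \<pi> d \<inter> label_edges n (labeling n \<rho> \<sigma> a b))
    = card {k \<in> P. (a k \<noteq> b (\<pi> k)) \<noteq> d k}"
proof -
  have "card {e \<in> matching n \<rho> \<sigma> \<pi> d. e \<in> label_edges n (labeling n \<rho> \<sigma> a b)}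
    = card {k \<in> P. (a k \<noteq> b (\<pi> k)) \<noteq> d k}"
    by (rule card_filter_matching[OF assms])
      (auto simp: label_edges_def edges_def labeling_def U_def V_def)
  then show ?thesis
    by (simp add: Int_def)
qed

section \<open>Moving vertices between positions\<close>

definition relabel :: "nat \<Rightarrow> ('a \<Rightarrow> 'a) \<Rightarrow> (nat \<Rightarrow> 'a) \<Rightarrow> nat \<Rightarrow> 'a" where
  "relabel n \<tau> \<rho> = restrict (\<tau> \<circ> \<rho>) {..<n}"

lemma placementsD: "\<rho> \<in> placements n P \<Longrightarrow> bij_betw \<rho> {..<n} P"
  by (simp add: placements_def)

lemma placements_mem: "\<rho> \<in> placements n P \<Longrightarrow> i < n \<Longrightarrow> \<rho> i \<in> P"
  using bij_betw_apply[OF placementsD] by auto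

lemma relabel_in_placements:
  assumes "\<rho> \<in> placements n P" "bij_betw \<tau> P P"
  shows "relabel n \<tau> \<rho> \<in> placements n P"
proof -
  have "bij_betw (\<tau> \<circ> \<rho>) {..<n} P"
    using placementsD[OF assms(1)] assms(2) by (rule bij_betw_trans)
  moreover have "bij_betw (relabel n \<tau> \<rho>) {..<n} P = bij_betw (\<tau> \<circ> \<rho>) {..<n} P"
    by (rule bij_betw_cong) (simp add: relabel_def)
  ultimately show ?thesis
    using bij_betw_apply[of "\<tau> \<circ> \<rho>" "{..<n}" P] by (auto simp: placements_def relabel_def)
qed

text \<open>Placements are extensional, so the restriction in \<open>relabel\<close> restores them
  exactly and not only on the indices below \<open>n\<close>.\<close>

lemma relabel_involution:
  assumes "\<rho> \<in> placements n P" "\<And>k. \<tau> (\<tau> k) = k"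
  shows "relabel n \<tau> (relabel n \<tau> \<rho>) = \<rho>"
proof
  fix i show "relabel n \<tau> (relabel n \<tau> \<rho>) i = \<rho> i"
    using assms by (cases "i < n") (auto simp: relabel_def placements_def dest: PiE_arb)
qed

lemma labeling_relabel:
  assumes "\<rho> \<in> placements n P" "\<sigma> \<in> placements n P"
    and "\<And>k. k \<in> P \<Longrightarrow> a (\<tau> k) = a' k" "\<And>k. k \<in> P \<Longrightarrow> b (\<tau>' k) = b' k"
  shows "labeling n (relabel n \<tau> \<rho>) (relabel n \<tau>' \<sigma>) a b = labeling n \<rho> \<sigma> a' b'"
  using assms(3,4) placements_mem[OF assms(1)] placements_mem[OF assms(2)]
  by (auto simp: labeling_def relabel_def U_def V_def intro!: restrict_ext)

text \<open>As \<open>\<tau>'\<close> is an involution, the matching condition after the move can be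
  solved for \<open>\<sigma> j\<close>; the partner map becomes the composition of
  \<open>\<tau>\<close>, \<open>\<pi>\<close> and \<open>\<tau>'\<close>.\<close>

lemma matching_relabel:
  assumes "\<rho> \<in> placements n P" "\<sigma> \<in> placements n P"
    and "\<And>k. \<tau>' (\<tau>' k) = k"
    and "\<And>k. k \<in> P \<Longrightarrow> \<tau>' (\<pi> (\<tau> k)) = \<pi>' k" "\<And>k. k \<in> P \<Longrightarrow> d (\<tau> k) = d' k"
  shows "matching n (relabel n \<tau> \<rho>) (relabel n \<tau>' \<sigma>) \<pi> d = matching n \<rho> \<sigma> \<pi>' d'"
proof -
  have "\<tau>' (\<sigma> j) = \<pi> (\<tau> (\<rho> i)) \<longleftrightarrow> \<sigma> j = \<pi>' (\<rho> i)" if "i < n" "j < n" for i j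
    using assms(3)[of "\<sigma> j"] assms(3)[of "\<pi> (\<tau> (\<rho> i))"]
      assms(4)[OF placements_mem[OF assms(1) that(1)]] by metis
  then show ?thesis
    using assms(5)[OF placements_mem[OF assms(1)]]
    by (auto simp: matching_def relabel_def)
qed

lemma labeling_cong:
  assumes "\<rho> \<in> placements n P" "\<sigma> \<in> placements n P"
    and "\<And>k. k \<in> P \<Longrightarrow> a k = a' k" "\<And>k. k \<in> P \<Longrightarrow> b k = b' k"
  shows "labeling n \<rho> \<sigma> a b = labeling n \<rho> \<sigma> a' b'"
  using assms(3,4) placements_mem[OF assms(1)] placements_mem[OF assms(2)]
  by (auto simp: labeling_def U_def V_def intro!: restrict_ext)

lemma matching_cong:
  assumes "\<rho> \<in> placements n P"
    and "\<And>k. k \<in> P \<Longrightarrow> \<pi> k = \<pi>' k" "\<And>k. k \<in> P \<Longrightarrow> d k = d' k"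
  shows "matching n \<rho> \<sigma> \<pi> d = matching n \<rho> \<sigma> \<pi>' d'"
  using assms(2,3)[OF placements_mem[OF assms(1)]] unfolding matching_def
  by (intro Collect_cong ex_cong1) auto

section \<open>Frames and the configurations placed on them\<close>

definition placed_labels :: "nat \<Rightarrow> (nat \<Rightarrow> pos) \<times> (nat \<Rightarrow> pos) \<Rightarrow> nat option \<Rightarrow> nat set \<Rightarrow> vertex \<Rightarrow> nat" where
  "placed_labels n h c z = labeling n (fst h) (snd h) (left_label (odd n) c z) (right_label c z)"

definition placed_matching :: "nat \<Rightarrow> (nat \<Rightarrow> pos) \<times> (nat \<Rightarrow> pos) \<Rightarrow> nat option \<Rightarrow> nat set \<Rightarrow> edge set" where
  "placed_matching n h e t = matching n (fst h) (snd h) (partner e t) (blue (odd n) e t)"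

text \<open>The two sides are placed independently, so that a symmetry may move \<open>U\<close> and
  \<open>V\<close> differently, as \<open>swap_alice\<close> does.\<close>

definition frames :: "nat \<Rightarrow> nat \<Rightarrow> nat \<Rightarrow> ((nat \<Rightarrow> pos) \<times> (nat \<Rightarrow> pos)) set" where
  "frames n p q = placements n (positions p q) \<times> placements n (positions p q)"

lemma finite_frames: "finite (frames n p q)"
  by (simp add: frames_def finite_placements finite_positions)

lemma frames_nonempty: "n = 6 + p + 2 * q \<Longrightarrow> frames n p q \<noteq> {}"
  using placements_nonempty[OF finite_positions, of p q n] by (auto simp: frames_def card_positions)

lemma framesD:
  assumes "h \<in> frames n p q"
  shows "fst h \<in> placements n (positions p q)" "snd h \<in> placements n (positions p q)"
  using assms by (auto simp: frames_def)

text \<open>Zones, \<open>Alice\<close> and \<open>Bob\<close> contribute an even number of labels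
  1, so \<open>Spare\<close> alone decides the parity; its label in \<open>U\<close> is 1 exactly
  for odd \<open>n\<close>.\<close>

lemma placed_labels_in_labelings:
  assumes "h \<in> frames n p q" "n = 6 + p + 2 * q" and c: "\<And>i. c = Some i \<Longrightarrow> i < 5"
  shows "placed_labels n h c z \<in> labelings n"
  unfolding placed_labels_def
proof (rule labeling_in_labelings[OF placementsD placementsD])
  have zone: "even (\<Sum>k<5. of_bool (c = Some k) + of_bool (map_option nxt c = Some k) :: nat)"
  proof (cases c)
    case (Some i)
    then show ?thesis
      using less_5_cases[OF c[OF Some]] by (auto simp: sum_less_5 nxt_simps)
  qed simp
  have alice: "even (\<Sum>j<p. of_bool (j \<in> z) + of_bool (j \<in> z) :: nat)"
    by (rule dvd_sum) simp
  show "even ((\<Sum>k\<in>positions p q. of_bool (left_label (odd n) c z k) + of_bool (right_label c z k)) + n)"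
    using zone alice assms(2) by (simp add: sum_positions)
qed (use framesD[OF assms(1)] in auto)

text \<open>Red edges at zones and at \<open>Bob\<close> come in pairs. The \<open>p\<close> edges
  at \<open>Alice\<close> are red, and \<open>Spare\<close> is red exactly when \<open>n\<close>,
  equivalently \<open>p\<close>, is even; together these are an odd number.\<close>

lemma placed_matching_odd_perfect_matching:
  assumes "h \<in> frames n p q" "n = 6 + p + 2 * q" and e: "\<And>i. e = Some i \<Longrightarrow> i < 5"
  shows "perfect_matching n (placed_matching n h e t)" "odd (card {(u, v, c) \<in> placed_matching n h e t. c = Red})"
proof -
  have "bij_betw (partner e t) (positions p q) (positions p q)"
    by (rule bij_betw_partner) (rule e)
  note bij = placementsD[OF framesD(1)[OF assms(1)]] placementsD[OF framesD(2)[OF assms(1)]] this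
  show "perfect_matching n (placed_matching n h e t)"
    unfolding placed_matching_def by (rule perfect_matching_matching[OF bij])
  have "card {k \<in> positions p q. \<not> blue (odd n) e t k}
      = (\<Sum>k\<in>positions p q. of_bool (\<not> blue (odd n) e t k))"
    by (simp add: finite_positions Int_def)
  moreover have "even (\<Sum>k<5. of_bool (\<not> blue (odd n) e t (Zone k)) :: nat)"
  proof (cases e)
    case (Some i)
    then show ?thesis
      using less_5_cases[OF e[OF Some]] by (auto simp: sum_less_5 nxt_simps)
  qed simp
  moreover have "even (\<Sum>j<q. of_bool (j \<in> t) + of_bool (j \<in> t) :: nat)"
    by (rule dvd_sum) simp
  ultimately have "odd (card {k \<in> positions p q. \<not> blue (odd n) e t k})"
    using assms(2) by (simp add: sum_positions)
  then show "odd (card {(u, v, c) \<in> placed_matching n h e t. c = Red})"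
    unfolding placed_matching_def by (simp only: card_red_matching[OF bij] not_False_eq_True)
qed

lemma card_placed_matching_label_edges:
  assumes "h \<in> frames n p q" and e: "\<And>i. e = Some i \<Longrightarrow> i < 5"
  shows "card (placed_matching n h e t \<inter> label_edges n (placed_labels n h c z)) = card (violations c e)"
proof -
  have "bij_betw (partner e t) (positions p q) (positions p q)"
    by (rule bij_betw_partner) (rule e)
  note bij = placementsD[OF framesD(1)[OF assms(1)]] placementsD[OF framesD(2)[OF assms(1)]] this
  have "card (Zone ` violations c e) = card (violations c e)"
    by (simp add: card_image inj_on_def)
  moreover have "{k \<in> positions p q. (left_label (odd n) c z k \<noteq> right_label c z (partner e t k))
      \<noteq> blue (odd n) e t k} = Zone ` violations c e"
    by (rule violated_positions)
  ultimately show ?thesis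
    unfolding placed_matching_def placed_labels_def by (simp only: card_matching_label_edges[OF bij])
qed

section \<open>Symmetries\<close>

text \<open>The edge from \<open>Zone i\<close> in \<open>U\<close> to \<open>Zone (nxt i)\<close>
  in \<open>V\<close>, present for \<open>e = Some i\<close>, changes places with the edge at
  \<open>Alice j\<close>; the other crossed edge stays.\<close>

definition swap_alice :: "nat \<Rightarrow> nat \<Rightarrow> nat \<Rightarrow> (nat \<Rightarrow> pos) \<times> (nat \<Rightarrow> pos) \<Rightarrow> (nat \<Rightarrow> pos) \<times> (nat \<Rightarrow> pos)" where
  "swap_alice n i j h =
     (relabel n (Transposition.transpose (Zone i) (Alice j)) (fst h),
      relabel n (Transposition.transpose (Zone (nxt i)) (Alice j)) (snd h))"

definition block_swap :: "nat \<Rightarrow> nat \<Rightarrow> pos \<Rightarrow> pos" where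
  "block_swap i j =
     Transposition.transpose (Zone i) (Bob j True) \<circ> Transposition.transpose (Zone (nxt i)) (Bob j False)"

definition swap_bob :: "nat \<Rightarrow> nat \<Rightarrow> nat \<Rightarrow> (nat \<Rightarrow> pos) \<times> (nat \<Rightarrow> pos) \<Rightarrow> (nat \<Rightarrow> pos) \<times> (nat \<Rightarrow> pos)" where
  "swap_bob n i j h = (relabel n (block_swap i j) (fst h), relabel n (block_swap i j) (snd h))"

lemma swap_alice_frames:
  assumes "h \<in> frames n p q" "i < 5" "j < p"
  shows "swap_alice n i j h \<in> frames n p q" "swap_alice n i j (swap_alice n i j h) = h"
proof -
  have "bij_betw (Transposition.transpose (Zone k) (Alice j)) (positions p q) (positions p q)" if "k < 5" for k
    using that assms(3) by (simp add: positions_def image_iff)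
  then show "swap_alice n i j h \<in> frames n p q"
    using assms nxt_less[of i] by (auto simp: swap_alice_def frames_def intro!: relabel_in_placements)
  show "swap_alice n i j (swap_alice n i j h) = h"
    using assms(1) by (auto simp: swap_alice_def frames_def relabel_involution)
qed

text \<open>The two exchanged edges are both red, so the matching cannot tell them apart.\<close>

lemma placed_matching_swap_alice:
  assumes "h \<in> frames n p q" "i < 5"
  shows "placed_matching n (swap_alice n i j h) (Some i) t = placed_matching n h (Some i) t"
  unfolding placed_matching_def swap_alice_def fst_conv snd_conv
proof (rule matching_relabel[OF framesD[OF assms(1)]])
  fix k
  show "Transposition.transpose (Zone (nxt i)) (Alice j)
      (partner (Some i) t (Transposition.transpose (Zone i) (Alice j) k)) = partner (Some i) t k"
    by (cases k) (auto simp: Transposition.transpose_def)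
  show "blue (odd n) (Some i) t (Transposition.transpose (Zone i) (Alice j) k)
      = blue (odd n) (Some i) t k"
    by (cases k) (auto simp: Transposition.transpose_def)
qed simp

lemma transpose_image_iff:
  "k \<in> Transposition.transpose a b ` w \<longleftrightarrow> Transposition.transpose a b k \<in> w"
  by (metis image_iff transpose_involutory)

text \<open>Both endpoints of the moved zone edge have label 1 for \<open>c = Some i\<close> and 0
  for \<open>c = None\<close>. So \<open>c\<close> acts like membership of one more coordinate
  \<open>p\<close>, and the swap exchanges the coordinates \<open>j\<close> and
  \<open>p\<close>.\<close>

lemma placed_labels_swap_alice:
  assumes "h \<in> frames n p q" "i < 5" "j < p"
  shows "placed_labels n (swap_alice n i j h) (if p \<in> w then Some i else None) w
    = placed_labels n h (if p \<in> Transposition.transpose j p ` w then Some i else None)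
        (Transposition.transpose j p ` w)"
  unfolding placed_labels_def swap_alice_def fst_conv snd_conv
proof (rule labeling_relabel[OF framesD[OF assms(1)]])
  fix k assume "k \<in> positions p q"
  then have k: "k \<noteq> Alice p"
    by (auto simp: positions_def)
  let ?w = "Transposition.transpose j p ` w"
  show "left_label (odd n) (if p \<in> w then Some i else None) w
      (Transposition.transpose (Zone i) (Alice j) k)
      = left_label (odd n) (if p \<in> ?w then Some i else None) ?w k"
    using k assms(3) by (cases k) (auto simp: transpose_image_iff Transposition.transpose_def)
  show "right_label (if p \<in> w then Some i else None) w
      (Transposition.transpose (Zone (nxt i)) (Alice j) k)
      = right_label (if p \<in> ?w then Some i else None) ?w k"
    using k assms(3) by (cases k) (auto simp: transpose_image_iff Transposition.transpose_def)
qed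

lemma block_swap_simps:
  assumes "i < 5"
  shows "block_swap i j (Zone k) =
      (if k = i then Bob j True else if k = nxt i then Bob j False else Zone k)"
    "block_swap i j Spare = Spare"
    "block_swap i j (Alice l) = Alice l"
    "block_swap i j (Bob l b) =
      (if l = j then if b then Zone i else Zone (nxt i) else Bob l b)"
  using nxt_neq[OF assms] by (auto simp: block_swap_def Transposition.transpose_def)

lemma block_swap_involution: "i < 5 \<Longrightarrow> block_swap i j (block_swap i j k) = k"
  using nxt_neq[of i] by (cases k) (auto simp: block_swap_simps)

lemma swap_bob_frames:
  assumes "h \<in> frames n p q" "i < 5" "j < q"
  shows "swap_bob n i j h \<in> frames n p q" "swap_bob n i j (swap_bob n i j h) = h"
proof -
  have "block_swap i j k \<in> positions p q" if "k \<in> positions p q" for k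
    using that assms(2,3) nxt_less[of i] by (cases k) (auto simp: block_swap_simps positions_def)
  then have "bij_betw (block_swap i j) (positions p q) (positions p q)"
    by (intro bij_betw_byWitness[where f' = "block_swap i j"])
      (use assms(2) in \<open>auto simp: block_swap_involution\<close>)
  then show "swap_bob n i j h \<in> frames n p q"
    using assms by (auto simp: swap_bob_def frames_def intro!: relabel_in_placements)
  show "swap_bob n i j (swap_bob n i j h) = h"
    using assms(1,2) by (auto simp: swap_bob_def frames_def relabel_involution block_swap_involution)
qed

text \<open>With \<open>c = Some i\<close> the labels in \<open>U\<close> and \<open>V\<close> are
  1, 0 at \<open>Zone i\<close> and 0, 1 at \<open>Zone (nxt i)\<close>, which agrees with
  \<open>Bob j True\<close> and \<open>Bob j False\<close>.\<close>

lemma placed_labels_swap_bob: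
  assumes "h \<in> frames n p q" "i < 5"
  shows "placed_labels n (swap_bob n i j h) (Some i) z = placed_labels n h (Some i) z"
  unfolding placed_labels_def swap_bob_def fst_conv snd_conv
proof (rule labeling_relabel[OF framesD[OF assms(1)]])
  fix k
  show "left_label (odd n) (Some i) z (block_swap i j k) = left_label (odd n) (Some i) z k"
    using nxt_neq[OF assms(2)] by (cases k) (auto simp: block_swap_simps assms(2))
  show "right_label (Some i) z (block_swap i j k) = right_label (Some i) z k"
    using nxt_neq[OF assms(2)] by (cases k) (auto simp: block_swap_simps assms(2))
qed

text \<open>A pair of zones is crossed and red for \<open>e = Some i\<close>, and straight and blue
  for \<open>e = None\<close>, just as a \<open>Bob\<close> pair with \<open>j \<in> t\<close> or
  not. So \<open>e\<close> acts like one more coordinate \<open>q\<close>.\<close>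

lemma placed_matching_swap_bob:
  assumes "h \<in> frames n p q" "i < 5" "j < q"
  shows "placed_matching n (swap_bob n i j h) (if q \<in> w then Some i else None) w
    = placed_matching n h (if q \<in> Transposition.transpose j q ` w then Some i else None)
        (Transposition.transpose j q ` w)"
  unfolding placed_matching_def swap_bob_def fst_conv snd_conv
proof (rule matching_relabel[OF framesD[OF assms(1)]])
  show "block_swap i j (block_swap i j k) = k" for k
    using assms(2) by (rule block_swap_involution)
  fix k assume "k \<in> positions p q"
  then have k: "k \<noteq> Bob q b" for b
    by (auto simp: positions_def)
  let ?w = "Transposition.transpose j q ` w"
  show "block_swap i j (partner (if q \<in> w then Some i else None) w (block_swap i j k))
      = partner (if q \<in> ?w then Some i else None) ?w k"
    using k assms(3) nxt_neq[OF assms(2)]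
    by (cases k) (auto simp: block_swap_simps assms(2) transpose_image_iff Transposition.transpose_def)
  show "blue (odd n) (if q \<in> w then Some i else None) w (block_swap i j k)
      = blue (odd n) (if q \<in> ?w then Some i else None) ?w k"
    using k assms(3) nxt_neq[OF assms(2)]
    by (cases k) (auto simp: block_swap_simps assms(2) transpose_image_iff Transposition.transpose_def)
qed

text \<open>There is no position \<open>Alice p\<close>; the element \<open>p\<close> only serves as
  a flag for the choice of \<open>c\<close>.\<close>

lemma placed_labels_insert:
  assumes "h \<in> frames n p q"
  shows "placed_labels n h c (insert p z) = placed_labels n h c z"
  unfolding placed_labels_def
proof (rule labeling_cong[OF framesD[OF assms]])
  fix k assume "k \<in> positions p q"
  then show "left_label (odd n) c (insert p z) k = left_label (odd n) c z k"
    "right_label c (insert p z) k = right_label c z k"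
    by (cases k; auto simp: positions_def)+
qed

lemma placed_matching_insert:
  assumes "h \<in> frames n p q"
  shows "placed_matching n h e (insert q t) = placed_matching n h e t"
  unfolding placed_matching_def
proof (rule matching_cong[OF framesD(1)[OF assms]])
  fix k assume "k \<in> positions p q"
  then show "partner e (insert q t) k = partner e t k"
    "blue (odd n) e (insert q t) k = blue (odd n) e t k"
    by (cases k; auto simp: positions_def)+
qed

lemma sum_Pow_atMost:
  fixes f :: "nat set \<Rightarrow> 'b::comm_monoid_add"
  shows "(\<Sum>w\<in>Pow {..m}. f w) = (\<Sum>z\<in>Pow {..<m}. f z) + (\<Sum>z\<in>Pow {..<m}. f (insert m z))"
proof -
  have "{..m} = insert m {..<m}"
    by auto
  then have "Pow {..m} = Pow {..<m} \<union> insert m ` Pow {..<m}"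
    by (simp add: Pow_insert)
  moreover have "Pow {..<m} \<inter> insert m ` Pow {..<m} = {}"
    by auto
  moreover have "inj_on (insert m) (Pow {..<m})"
    by (rule inj_on_inverseI[where g = "\<lambda>w. w - {m}"]) auto
  ultimately show ?thesis
    by (simp add: sum.union_disjoint sum.reindex)
qed

text \<open>Among pairwise intersecting edges of a pentagon there are at most two, so at most two of the
  products \<open>P i\<close> in the proof are non-zero.\<close>

lemma sum_pentagon_le:
  fixes F G :: "nat option \<Rightarrow> real"
  assumes nonneg: "0 \<le> F None" "0 \<le> G None"
      "\<And>i. i < 5 \<Longrightarrow> 0 \<le> F (Some i)" "\<And>i. i < 5 \<Longrightarrow> 0 \<le> G (Some i)"
    and zero: "\<And>i j. i < 5 \<Longrightarrow> j < 5 \<Longrightarrow> {i, nxt i} \<inter> {j, nxt j} = {} \<Longrightarrow> F (Some i) * G (Some j) = 0"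
  shows "(\<Sum>i<5. F (Some i) * G (Some i)) \<le> 2 * (F None * G None)
    + (\<Sum>i<5. \<bar>F (Some i) - F None\<bar> * G (Some i) + F (Some i) * \<bar>G (Some i) - G None\<bar>)"
proof -
  \<comment> \<open>With minima, \<open>P i\<close> vanishes as soon as one modified weight does,
    and it is still bounded by the initial product \<open>F None * G None\<close>.\<close>
  define P where "P i = min (F (Some i)) (F None) * min (G (Some i)) (G None)" for i
  have P_le: "0 \<le> P i" "P i \<le> F None * G None" if "i < 5" for i
    using nonneg that by (auto simp: P_def intro: mult_mono)
  have disj: "P i = 0 \<or> P j = 0" if "i < 5" "j < 5" "{i, nxt i} \<inter> {j, nxt j} = {}" for i j
  proof (cases "F (Some i) = 0")
    case True
    then show ?thesis using nonneg(1) by (simp add: P_def)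
  next
    case False
    then have "G (Some j) = 0" using zero[OF that] by simp
    then show ?thesis using nonneg(2) by (simp add: P_def)
  qed
  \<comment> \<open>The five pairs of disjoint sides form a 5-cycle 0, 2, 4, 1, 3; no three of its
    vertices are pairwise non-adjacent.\<close>
  have "P 0 = 0 \<or> P 2 = 0" "P 0 = 0 \<or> P 3 = 0" "P 1 = 0 \<or> P 3 = 0" "P 1 = 0 \<or> P 4 = 0"
    "P 2 = 0 \<or> P 4 = 0"
    by (rule disj; simp add: nxt_simps)+
  then have "P 0 + P 1 + P 2 + P 3 + P 4 \<le> 2 * (F None * G None)"
    using P_le[of 0] P_le[of 1] P_le[of 2] P_le[of 3] P_le[of 4] by (elim disjE) simp_all
  then have sum_P: "(\<Sum>i<5. P i) \<le> 2 * (F None * G None)"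
    by (simp add: sum_less_5)
  have "F (Some i) * G (Some i)
      \<le> P i + (\<bar>F (Some i) - F None\<bar> * G (Some i) + F (Some i) * \<bar>G (Some i) - G None\<bar>)" if "i < 5" for i
  proof -
    let ?f = "min (F (Some i)) (F None)" and ?g = "min (G (Some i)) (G None)"
    have "F (Some i) * G (Some i) - P i = (F (Some i) - ?f) * G (Some i) + ?f * (G (Some i) - ?g)"
      by (simp add: P_def algebra_simps)
    also have "\<dots> \<le> \<bar>F (Some i) - F None\<bar> * G (Some i) + F (Some i) * \<bar>G (Some i) - G None\<bar>"
      using nonneg that by (intro add_mono mult_right_mono mult_mono) auto
    finally show ?thesis by simp
  qed
  then have "(\<Sum>i<5. F (Some i) * G (Some i)) \<le> (\<Sum>i<5. P i
      + (\<bar>F (Some i) - F None\<bar> * G (Some i) + F (Some i) * \<bar>G (Some i) - G None\<bar>))"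
    by (intro sum_mono) auto
  then show ?thesis
    using sum_P by (simp add: sum.distrib)
qed

section \<open>The polytope and its slacks\<close>

lemma lookup_scaleR:
  fixes x :: "'a \<Rightarrow>\<^sub>0 'b::real_vector"
  shows "Poly_Mapping.lookup (r *\<^sub>R x) e = r *\<^sub>R Poly_Mapping.lookup x e"
proof -
  have "finite {e. r *\<^sub>R Poly_Mapping.lookup x e \<noteq> 0}"
    by (rule finite_subset[OF _ finite_lookup[of x]]) auto
  then show ?thesis
    by (simp add: scaleR_poly_mapping_def)
qed

lemma lookup_char_vec: "finite M \<Longrightarrow> Poly_Mapping.lookup (char_vec M) e = of_bool (e \<in> M)"
  by (simp add: char_vec_def lookup_sum lookup_single when_def of_bool_def)

lemma keys_char_vec: "finite M \<Longrightarrow> Poly_Mapping.keys (char_vec M) = M"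
  by (auto simp: in_keys_iff lookup_char_vec)

lemma lin_form_char_vec:
  assumes "finite A" "finite M"
  shows "lin_form (char_vec A) (char_vec M) = card (M \<inter> A)"
proof -
  have "lin_form (char_vec A) (char_vec M) = (\<Sum>e\<in>A. of_bool (e \<in> M))"
    using assms by (simp add: lin_form_def keys_char_vec lookup_char_vec)
  then show ?thesis
    using assms by (simp add: Int_commute)
qed

lemma lin_form_uminus: "lin_form (- a) x = - lin_form a x"
  by (simp add: lin_form_def sum_negf)

lemma lin_form_combination: "lin_form a (r *\<^sub>R x + s *\<^sub>R y) = r * lin_form a x + s * lin_form a y"
  by (simp add: lin_form_def lookup_add lookup_scaleR sum.distrib sum_distrib_left algebra_simps)

lemma convex_slack_nonneg: "convex {x. 0 \<le> slack x C}"
proof (rule convexI)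
  fix x y and r s :: real
  assume xy: "x \<in> {x. 0 \<le> slack x C}" "y \<in> {x. 0 \<le> slack x C}" and rs: "0 \<le> r" "0 \<le> s" "r + s = 1"
  obtain a b where C: "slack z C = b - lin_form a z" for z
    by (cases C) auto
  have s: "s = 1 - r"
    using rs(3) by simp
  have "slack (r *\<^sub>R x + s *\<^sub>R y) C = r * slack x C + s * slack y C"
    unfolding C lin_form_combination s by (simp add: algebra_simps)
  then show "r *\<^sub>R x + s *\<^sub>R y \<in> {x. 0 \<le> slack x C}"
    using xy rs by simp
qed

lemma finite_edges: "finite (edges n)"
  by (simp add: edges_def U_def V_def)

lemma perfect_matching_finite: "perfect_matching n M \<Longrightarrow> finite M"
  using finite_edges finite_subset unfolding perfect_matching_def by blast

lemma finite_incident: "finite (incident n w)"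
  by (rule finite_subset[OF _ finite_edges[of n]]) (auto simp: incident_def)

lemma finite_label_edges: "finite (label_edges n L)"
  by (rule finite_subset[OF _ finite_edges[of n]]) (auto simp: label_edges_def)

text \<open>Double counting: every vertex is covered by exactly one edge of
  \<open>M\<close>.\<close>

lemma sum_perfect_matching:
  fixes g :: "vertex \<Rightarrow> nat"
  assumes M: "perfect_matching n M"
  shows "(\<Sum>(u, v, c)\<in>M. g u + g v) = (\<Sum>w\<in>U n \<union> V n. g w)"
proof -
  let ?W = "U n \<union> V n"
  have "(\<Sum>w\<in>?W. g w) = (\<Sum>w\<in>?W. \<Sum>e\<in>M. if e \<in> incident n w then g w else 0)"
  proof (rule sum.cong)
    fix w assume "w \<in> ?W"
    then have "card (M \<inter> incident n w) = 1"
      using M by (simp add: perfect_matching_def)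
    then show "g w = (\<Sum>e\<in>M. if e \<in> incident n w then g w else 0)"
      using perfect_matching_finite[OF M] by (simp flip: sum.inter_restrict)
  qed simp
  also have "\<dots> = (\<Sum>e\<in>M. \<Sum>w\<in>?W. if e \<in> incident n w then g w else 0)"
    by (rule sum.swap)
  also have "\<dots> = (\<Sum>(u, v, c)\<in>M. g u + g v)"
  proof (rule sum.cong)
    fix e assume "e \<in> M"
    moreover obtain u v c where e: "e = (u, v, c)" by (rule prod_cases3)
    ultimately have uv: "(u, v, c) \<in> edges n"
      using M by (auto simp: perfect_matching_def)
    have "(\<Sum>w\<in>?W. if e \<in> incident n w then g w else 0) = (\<Sum>w\<in>?W. if w \<in> {u, v} then g w else 0)"
      by (rule sum.cong) (use uv in \<open>auto simp: e incident_def\<close>)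
    also have "\<dots> = (\<Sum>w\<in>?W \<inter> {u, v}. g w)"
      by (rule sum.inter_restrict[symmetric]) (simp add: U_def V_def)
    also have "?W \<inter> {u, v} = {u, v}"
      using uv by (auto simp: edges_def)
    also have "(\<Sum>w\<in>{u, v}. g w) = g u + g v"
      using uv by (subst sum.insert) (auto simp: edges_def U_def V_def)
    finally show "(\<Sum>w\<in>?W. if e \<in> incident n w then g w else 0) = (case e of (u, v, c) \<Rightarrow> g u + g v)"
      by (simp add: e)
  qed simp
  finally show ?thesis by simp
qed

lemma card_perfect_matching:
  assumes "perfect_matching n M"
  shows "card M = n"
proof -
  have "(\<Sum>(u, v, c)\<in>M. of_bool (u \<in> U n) + of_bool (v \<in> U n)) = (\<Sum>e\<in>M. 1 :: nat)"
    using assms by (intro sum.cong) (auto simp: perfect_matching_def edges_def U_def V_def)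
  moreover have "(\<Sum>w\<in>U n \<union> V n. of_bool (w \<in> U n)) = (\<Sum>w\<in>U n. 1 :: nat)"
    by (rule sum.mono_neutral_cong_right) (auto simp: U_def V_def)
  moreover have "card (U n) = n"
    by (simp add: U_def card_image)
  ultimately show ?thesis
    using sum_perfect_matching[OF assms, of "\<lambda>w. of_bool (w \<in> U n)"] by simp
qed

text \<open>For each edge the indicator of \<open>E\<^sub>L\<close>, both labels, the indicator of
  red and 1 have an even sum. Over \<open>M\<close>, the labels add up to \<open>n\<close> modulo 2,
  the red indicators to an odd number and the ones to \<open>n\<close>.\<close>

lemma odd_card_label_edges:
  assumes M: "perfect_matching n M" and red: "odd (card {(u, v, c) \<in> M. c = Red})"
    and L: "L \<in> labelings n"
  shows "odd (card (M \<inter> label_edges n L))"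
proof -
  have fin: "finite M"
    using M by (rule perfect_matching_finite)
  have 01: "L w = 0 \<or> L w = 1" if "w \<in> U n \<union> V n" for w
  proof -
    have "L w \<in> {0, 1}"
      using L that unfolding labelings_def by (blast dest: PiE_mem)
    then show ?thesis by simp
  qed
  have "(\<Sum>w\<in>U n \<union> V n. L w) = (\<Sum>w\<in>U n \<union> V n. of_bool (L w = 1))"
    by (rule sum.cong) (use 01 in force)+
  also have "\<dots> = card {w \<in> U n \<union> V n. L w = 1}"
    by (simp add: U_def V_def Int_def)
  finally have "[(\<Sum>w\<in>U n \<union> V n. L w) = n] (mod 2)"
    using L by (simp add: labelings_def)
  then have labels: "even ((\<Sum>(u, v, c)\<in>M. L u + L v) + n)"
    by (simp add: sum_perfect_matching[OF M] cong_mod2_iff)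
  have "(\<Sum>(u, v, c)\<in>M. (of_bool (c = Red) :: nat)) = (\<Sum>e\<in>M. of_bool (snd (snd e) = Red))"
    by (simp add: case_prod_beta)
  also have "\<dots> = card (M \<inter> {e. snd (snd e) = Red})"
    using fin by simp
  also have "M \<inter> {e. snd (snd e) = Red} = {(u, v, c) \<in> M. c = Red}"
    by auto
  finally have reds: "odd (\<Sum>(u, v, c)\<in>M. of_bool (c = Red) :: nat)"
    using red by simp
  have "card (M \<inter> label_edges n L) = (\<Sum>e\<in>M. of_bool (e \<in> label_edges n L))"
    using fin by simp
  also have "even (\<dots> + (\<Sum>(u, v, c)\<in>M. (L u + L v) + of_bool (c = Red) + 1))"
    unfolding sum.distrib[symmetric]
  proof (rule dvd_sum)
    fix e assume "e \<in> M"
    moreover obtain u v c where e: "e = (u, v, c)" by (rule prod_cases3)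
    ultimately have uv: "(u, v, c) \<in> edges n"
      using M by (auto simp: perfect_matching_def)
    then have "L u = 0 \<or> L u = 1" "L v = 0 \<or> L v = 1"
      using 01 by (auto simp: edges_def)
    then show "even (of_bool (e \<in> label_edges n L)
        + (case e of (u, v, c) \<Rightarrow> (L u + L v) + of_bool (c = Red) + 1))"
      using uv by (cases c) (auto simp: e label_edges_def)
  qed
  also have "(\<Sum>(u, v, c)\<in>M. (L u + L v) + of_bool (c = Red) + 1)
      = (\<Sum>(u, v, c)\<in>M. L u + L v) + (\<Sum>(u, v, c)\<in>M. of_bool (c = Red)) + n"
    using card_perfect_matching[OF M] by (simp add: case_prod_beta sum.distrib sum_Suc)
  finally show ?thesis
    using labels reds by simp
qed

lemma slack_label_edges:
  assumes "finite M"
  shows "slack (char_vec M) (Ge (char_vec (label_edges n L)) 1) = real (card (M \<inter> label_edges n L)) - 1"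
  using assms by (simp add: lin_form_uminus lin_form_char_vec finite_label_edges)

text \<open>This guarantees that a non-negative factorization exists, without which the
  \<open>LEAST\<close> in \<open>nonneg_rank\<close> would say nothing. Half-spaces and hyperplanes
  being convex, it suffices to check the matchings.\<close>

lemma slack_nonneg:
  assumes "x \<in> odd_red_polytope n" "C \<in> constraint_system n"
  shows "0 \<le> slack x C"
proof -
  have "0 \<le> slack (char_vec M) C"
    if M: "perfect_matching n M" "odd (card {(u, v, c) \<in> M. c = Red})" for M
  proof -
    note fin = perfect_matching_finite[OF M(1)]
    from assms(2) consider w where "w \<in> U n \<union> V n" "C = Eq (char_vec (incident n w)) 1"
      | L where "L \<in> labelings n" "C = Ge (char_vec (label_edges n L)) 1"
      | e where "C = Ge (char_vec {e}) 0"
      unfolding constraint_system_def by blast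
    then show ?thesis
    proof cases
      case 1
      then show ?thesis
        using M fin by (simp add: lin_form_char_vec finite_incident perfect_matching_def)
    next
      case 2
      have "card (M \<inter> label_edges n L) \<noteq> 0"
        using odd_card_label_edges[OF M 2(1)] by (metis even_zero)
      then show ?thesis
        unfolding 2(2) slack_label_edges[OF fin] by simp
    next
      case 3
      then show ?thesis
        using fin by (simp add: lin_form_uminus lin_form_char_vec)
    qed
  qed
  then have "odd_red_polytope n \<subseteq> {x. 0 \<le> slack x C}"
    unfolding odd_red_polytope_def by (intro hull_minimal convex_slack_nonneg) auto
  then show ?thesis
    using assms(1) by auto
qed

text \<open>A 0/1 vector is a vertex of the unit box, which contains the polytope; so it is an
  extreme point of the polytope and belongs to every generating set.\<close>

lemma char_vec_in_generators:
  assumes X: "convex hull X = odd_red_polytope n"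
    and M: "perfect_matching n M" "odd (card {(u, v, c) \<in> M. c = Red})"
  shows "char_vec M \<in> X"
proof -
  let ?box = "{x :: edge \<Rightarrow>\<^sub>0 real. \<forall>e. 0 \<le> Poly_Mapping.lookup x e \<and> Poly_Mapping.lookup x e \<le> 1}"
  note fin = perfect_matching_finite
  have "convex ?box"
    by (rule convexI) (auto simp: lookup_add lookup_scaleR intro: convex_bound_le)
  then have box: "odd_red_polytope n \<subseteq> ?box"
    unfolding odd_red_polytope_def
    by (intro hull_minimal) (auto simp: lookup_char_vec dest!: fin)
  have "char_vec M \<in> convex hull X"
    unfolding X odd_red_polytope_def by (rule hull_inc) (use M in blast)
  moreover have "char_vec M \<notin> open_segment a b"
    if "a \<in> convex hull X" "b \<in> convex hull X" for a b
  proof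
    assume "char_vec M \<in> open_segment a b"
    then obtain r where "a \<noteq> b" and r: "0 < r" "r < 1" "char_vec M = (1 - r) *\<^sub>R a + r *\<^sub>R b"
      by (auto simp: in_segment)
    have "Poly_Mapping.lookup a e = Poly_Mapping.lookup b e" for e
    proof -
      let ?a = "Poly_Mapping.lookup a e" and ?b = "Poly_Mapping.lookup b e"
      have ab: "0 \<le> ?a" "?a \<le> 1" "0 \<le> ?b" "?b \<le> 1"
        using that box unfolding X by blast+
      have eq: "(1 - r) * ?a + r * ?b = of_bool (e \<in> M)"
        using lookup_char_vec[OF fin[OF M(1)], of e] unfolding r(3)
        by (simp add: lookup_add lookup_scaleR)
      show ?thesis
      proof (cases "e \<in> M")
        case True
        \<comment> \<open>Two non-negative terms with sum 0 both vanish, and \<open>r\<close> lies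
          strictly between 0 and 1, so both coordinates equal 1.\<close>
        then have "(1 - r) * (1 - ?a) + r * (1 - ?b) = 0"
          using eq by (simp add: algebra_simps)
        moreover have "0 \<le> (1 - r) * (1 - ?a)" "0 \<le> r * (1 - ?b)"
          using ab r by auto
        ultimately have "(1 - r) * (1 - ?a) = 0" "r * (1 - ?b) = 0"
          by linarith+
        then show ?thesis using r by simp
      next
        case False
        then have "(1 - r) * ?a + r * ?b = 0"
          using eq by simp
        moreover have "0 \<le> (1 - r) * ?a" "0 \<le> r * ?b"
          using ab r by auto
        ultimately have "(1 - r) * ?a = 0" "r * ?b = 0"
          by linarith+
        then show ?thesis using r by simp
      qed
    qed
    then have "a = b" by (intro poly_mapping_eqI) auto
    with \<open>a \<noteq> b\<close> show False ..
  qed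
  ultimately have "char_vec M extreme_point_of (convex hull X)"
    by (simp add: extreme_point_of_def)
  then show ?thesis
    by (rule extreme_point_of_convex_hull)
qed

text \<open>The trivial factorization has one term for each row.\<close>

lemma has_nonneg_factorization_card:
  assumes "finite A" and nonneg: "\<And>i j. i \<in> A \<Longrightarrow> j \<in> B \<Longrightarrow> 0 \<le> S i j"
  shows "has_nonneg_factorization A B S (card A)"
proof -
  obtain h where h: "bij_betw h {..<card A} A"
    using ex_bij_betw_nat_finite[OF assms(1)] by (auto simp: lessThan_atLeast0)
  have "S i j = (\<Sum>k<card A. of_bool (i = h k) * S (h k) j)" if "i \<in> A" for i j
    using sum.reindex_bij_betw[OF h, of "\<lambda>i'. of_bool (i = i') * S i' j"] that assms(1)
    by (simp add: of_bool_def if_distrib[of "\<lambda>x. x * _"] cong: if_cong)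
  then show ?thesis
    unfolding has_nonneg_factorization_def
    by (intro exI[of _ "\<lambda>k i. of_bool (i = h k)"] exI[of _ "\<lambda>k j. S (h k) j"])
      (use nonneg bij_betw_apply[OF h] in auto)
qed

lemma nonneg_rank_factorization:
  assumes "finite A" "\<And>i j. i \<in> A \<Longrightarrow> j \<in> B \<Longrightarrow> 0 \<le> S i j"
  shows "has_nonneg_factorization A B S (nonneg_rank A B S)"
  unfolding nonneg_rank_def by (rule LeastI) (rule has_nonneg_factorization_card[OF assms])

section \<open>Bound for one term of a factorization\<close>

text \<open>Labelings depend only on \<open>z\<close> and matchings only on \<open>t\<close>. Hence,
  on a fixed frame, a rank-one term summed over all \<open>z\<close> and \<open>t\<close> is the
  product of this weight and \<open>matching_weight\<close>. The sums are left unnormalized.\<close>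

definition label_weight :: "((vertex \<Rightarrow> nat) \<Rightarrow> real) \<Rightarrow> nat \<Rightarrow> nat
    \<Rightarrow> (nat \<Rightarrow> pos) \<times> (nat \<Rightarrow> pos) \<Rightarrow> nat option \<Rightarrow> real" where
  "label_weight u n p h c = (\<Sum>z\<in>Pow {..<p}. u (placed_labels n h c z))"

definition matching_weight :: "(edge set \<Rightarrow> real) \<Rightarrow> nat \<Rightarrow> nat
    \<Rightarrow> (nat \<Rightarrow> pos) \<times> (nat \<Rightarrow> pos) \<Rightarrow> nat option \<Rightarrow> real" where
  "matching_weight v n q h e = (\<Sum>t\<in>Pow {..<q}. v (placed_matching n h e t))"

definition odd_matchings :: "nat \<Rightarrow> edge set set" where
  "odd_matchings n = {M. perfect_matching n M \<and> odd (card {(u, v, c) \<in> M. c = Red})}"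

lemma finite_labelings: "finite (labelings n)"
proof -
  have "labelings n \<subseteq> (U n \<union> V n) \<rightarrow>\<^sub>E {0, 1}"
    by (auto simp: labelings_def)
  moreover have "finite ((U n \<union> V n) \<rightarrow>\<^sub>E {0, 1 :: nat})"
    by (rule finite_PiE) (auto simp: U_def V_def)
  ultimately show ?thesis
    by (rule finite_subset)
qed

lemma finite_odd_matchings: "finite (odd_matchings n)"
  by (rule finite_subset[of _ "Pow (edges n)"])
    (auto simp: odd_matchings_def perfect_matching_def finite_edges)

lemma placed_matching_in_odd_matchings:
  assumes "h \<in> frames n p q" "n = 6 + p + 2 * q" "\<And>i. e = Some i \<Longrightarrow> i < 5"
  shows "placed_matching n h e t \<in> odd_matchings n"
  using placed_matching_odd_perfect_matching[OF assms] by (simp add: odd_matchings_def)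

lemma sum_Pow_walsh_last:
  fixes f :: "nat set \<Rightarrow> real"
  shows "(\<Sum>w\<in>Pow {..m}. walsh m w * f w)
    = (\<Sum>z\<in>Pow {..<m}. f (insert m z)) - (\<Sum>z\<in>Pow {..<m}. f z)"
proof -
  have "walsh m z = -1" if "z \<in> Pow {..<m}" for z
    using that by (auto simp: walsh_def)
  then show ?thesis
    by (simp add: sum_Pow_atMost walsh_def[of m "insert m _"] sum_negf)
qed

text \<open>This models a single term of a factorization; \<open>Cu\<close> and \<open>Cv\<close>
  will be the maxima of its two factors.\<close>

locale rank_one =
  fixes n p q :: nat and u :: "(vertex \<Rightarrow> nat) \<Rightarrow> real" and v :: "edge set \<Rightarrow> real" and Cu Cv \<epsilon> :: real
  assumes n: "n = 6 + p + 2 * q"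
    and u: "\<And>L. L \<in> labelings n \<Longrightarrow> 0 \<le> u L \<and> u L \<le> Cu"
    and v: "\<And>M. M \<in> odd_matchings n \<Longrightarrow> 0 \<le> v M \<and> v M \<le> Cv"
    and \<epsilon>: "0 \<le> \<epsilon>" "\<epsilon> \<le> 1"
begin

abbreviation "H \<equiv> frames n p q"
abbreviation "F \<equiv> label_weight u n p"
abbreviation "G \<equiv> matching_weight v n q"
text \<open>The Chernoff error, scaled by the largest possible total of the term over all frames and
  all \<open>z\<close>, \<open>t\<close>. The factor 2 comes from the additional coordinate of the
  cube.\<close>

abbreviation "tail m \<equiv> 2 * real (card H) * 2 ^ (p + q) * Cu * Cv * exp (- (\<epsilon>\<^sup>2 / 4 * Suc m))"

lemma u_placed: "h \<in> H \<Longrightarrow> (\<And>i. c = Some i \<Longrightarrow> i < 5) \<Longrightarrow> 0 \<le> u (placed_labels n h c z) \<and> u (placed_labels n h c z) \<le> Cu"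
  by (intro u placed_labels_in_labelings[OF _ n]) auto

lemma v_placed: "h \<in> H \<Longrightarrow> (\<And>i. e = Some i \<Longrightarrow> i < 5) \<Longrightarrow> 0 \<le> v (placed_matching n h e t) \<and> v (placed_matching n h e t) \<le> Cv"
  by (intro v placed_matching_in_odd_matchings[OF _ n]) auto

lemma F_bounds:
  assumes "h \<in> H" "\<And>i. c = Some i \<Longrightarrow> i < 5"
  shows "0 \<le> F h c" "F h c \<le> 2 ^ p * Cu"
proof -
  show "0 \<le> F h c"
    unfolding label_weight_def using u_placed[OF assms] by (simp add: sum_nonneg)
  have "F h c \<le> (\<Sum>z\<in>Pow {..<p}. Cu)"
    unfolding label_weight_def using u_placed[OF assms] by (intro sum_mono) simp
  then show "F h c \<le> 2 ^ p * Cu"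
    by (simp add: card_Pow)
qed

lemma G_bounds:
  assumes "h \<in> H" "\<And>i. e = Some i \<Longrightarrow> i < 5"
  shows "0 \<le> G h e" "G h e \<le> 2 ^ q * Cv"
proof -
  show "0 \<le> G h e"
    unfolding matching_weight_def using v_placed[OF assms] by (simp add: sum_nonneg)
  have "G h e \<le> (\<Sum>z\<in>Pow {..<q}. Cv)"
    unfolding matching_weight_def using v_placed[OF assms] by (intro sum_mono) simp
  then show "G h e \<le> 2 ^ q * Cv"
    by (simp add: card_Pow)
qed

lemma C_nonneg: "0 \<le> Cu" "0 \<le> Cv"
proof -
  obtain h where "h \<in> H" using frames_nonempty[OF n] by blast
  from u_placed[OF this, of None] v_placed[OF this, of None] show "0 \<le> Cu" "0 \<le> Cv" by force+
qed

text \<open>\<open>G h (Some i)\<close> is invariant under \<open>swap_alice\<close>, so it can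
  serve as the weight in the correlation bound.\<close>

lemma label_deviation:
  assumes i: "i < 5"
  shows "(\<Sum>h\<in>H. \<bar>F h (Some i) - F h None\<bar> * G h (Some i))
    \<le> \<epsilon> * (\<Sum>h\<in>H. (F h None + F h (Some i)) * G h (Some i)) + tail p"
proof -
  \<comment> \<open>The choice between \<open>None\<close> and \<open>Some i\<close> becomes
    coordinate \<open>p\<close>; the correlation with it is
    \<open>F h (Some i) - F h None\<close>.\<close>
  define \<phi> where "\<phi> h w = u (placed_labels n h (if p \<in> w then Some i else None) w)" for h w
  have small: "p \<notin> z" if "z \<in> Pow {..<p}" for z
    using that by auto
  have \<phi>_insert: "(\<Sum>z\<in>Pow {..<p}. \<phi> h (insert p z)) = F h (Some i)" if "h \<in> H" for h
    using that by (simp add: \<phi>_def label_weight_def placed_labels_insert)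
  have \<phi>_plain: "(\<Sum>z\<in>Pow {..<p}. \<phi> h z) = F h None" for h
    using small by (simp add: \<phi>_def label_weight_def)
  have G: "0 \<le> G h (Some i)" "G h (Some i) \<le> 2 ^ q * Cv" if "h \<in> H" for h
    using G_bounds[OF that, of "Some i"] i by auto
  have "(\<Sum>h\<in>H. G h (Some i) * \<bar>\<Sum>w\<in>Pow {..p}. walsh p w * \<phi> h w\<bar>)
    \<le> \<epsilon> * (\<Sum>h\<in>H. G h (Some i) * (\<Sum>w\<in>Pow {..p}. \<phi> h w))
      + Cu * 2 ^ Suc p * exp (- (\<epsilon>\<^sup>2 / 4 * Suc p)) * (\<Sum>h\<in>H. G h (Some i))"
  proof (rule sum_abs_last_walsh_le[where T = "swap_alice n i"])
    show "0 \<le> \<phi> h w" "\<phi> h w \<le> Cu" if "h \<in> H" for h w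
      using u_placed[OF that] i by (auto simp: \<phi>_def)
    show "\<phi> (swap_alice n i j h) w = \<phi> h (Transposition.transpose j p ` w)"
      if "j < p" "h \<in> H" for j h w
      unfolding \<phi>_def placed_labels_swap_alice[OF that(2) i that(1)] ..
    show "G (swap_alice n i j h) (Some i) = G h (Some i)" if "j < p" "h \<in> H" for j h
      unfolding matching_weight_def placed_matching_swap_alice[OF that(2) i] ..
  qed (use G swap_alice_frames i \<epsilon> in auto)
  also have "Cu * 2 ^ Suc p * exp (- (\<epsilon>\<^sup>2 / 4 * Suc p)) * (\<Sum>h\<in>H. G h (Some i))
      \<le> Cu * 2 ^ Suc p * exp (- (\<epsilon>\<^sup>2 / 4 * Suc p)) * (\<Sum>h\<in>H. 2 ^ q * Cv)"
    using C_nonneg G by (intro mult_left_mono sum_mono) auto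
  also have "\<dots> = tail p"
    by (simp add: power_add)
  finally show ?thesis
    by (simp add: sum_Pow_walsh_last sum_Pow_atMost \<phi>_insert \<phi>_plain mult.commute)
qed

text \<open>The roles are exchanged: \<open>swap_bob\<close> preserves \<open>F h (Some i)\<close>
  and permutes the coordinates of the matching.\<close>

lemma matching_deviation:
  assumes i: "i < 5"
  shows "(\<Sum>h\<in>H. F h (Some i) * \<bar>G h (Some i) - G h None\<bar>)
    \<le> \<epsilon> * (\<Sum>h\<in>H. F h (Some i) * (G h None + G h (Some i))) + tail q"
proof -
  define \<phi> where "\<phi> h w = v (placed_matching n h (if q \<in> w then Some i else None) w)" for h w
  have small: "q \<notin> z" if "z \<in> Pow {..<q}" for z
    using that by auto
  have \<phi>_insert: "(\<Sum>z\<in>Pow {..<q}. \<phi> h (insert q z)) = G h (Some i)" if "h \<in> H" for h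
    using that by (simp add: \<phi>_def matching_weight_def placed_matching_insert)
  have \<phi>_plain: "(\<Sum>z\<in>Pow {..<q}. \<phi> h z) = G h None" for h
    using small by (simp add: \<phi>_def matching_weight_def)
  have F: "0 \<le> F h (Some i)" "F h (Some i) \<le> 2 ^ p * Cu" if "h \<in> H" for h
    using F_bounds[OF that, of "Some i"] i by auto
  have "(\<Sum>h\<in>H. F h (Some i) * \<bar>\<Sum>w\<in>Pow {..q}. walsh q w * \<phi> h w\<bar>)
    \<le> \<epsilon> * (\<Sum>h\<in>H. F h (Some i) * (\<Sum>w\<in>Pow {..q}. \<phi> h w))
      + Cv * 2 ^ Suc q * exp (- (\<epsilon>\<^sup>2 / 4 * Suc q)) * (\<Sum>h\<in>H. F h (Some i))"
  proof (rule sum_abs_last_walsh_le[where T = "swap_bob n i"])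
    show "0 \<le> \<phi> h w" "\<phi> h w \<le> Cv" if "h \<in> H" for h w
      using v_placed[OF that] i by (auto simp: \<phi>_def)
    show "\<phi> (swap_bob n i j h) w = \<phi> h (Transposition.transpose j q ` w)"
      if "j < q" "h \<in> H" for j h w
      unfolding \<phi>_def placed_matching_swap_bob[OF that(2) i that(1)] ..
    show "F (swap_bob n i j h) (Some i) = F h (Some i)" if "j < q" "h \<in> H" for j h
      unfolding label_weight_def placed_labels_swap_bob[OF that(2) i] ..
  qed (use F swap_bob_frames i \<epsilon> in auto)
  also have "Cv * 2 ^ Suc q * exp (- (\<epsilon>\<^sup>2 / 4 * Suc q)) * (\<Sum>h\<in>H. F h (Some i))
      \<le> Cv * 2 ^ Suc q * exp (- (\<epsilon>\<^sup>2 / 4 * Suc q)) * (\<Sum>h\<in>H. 2 ^ p * Cu)"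
    using C_nonneg F by (intro mult_left_mono sum_mono) auto
  also have "\<dots> = tail q"
    by (simp add: power_add)
  finally show ?thesis
    by (simp add: sum_Pow_walsh_last sum_Pow_atMost \<phi>_insert \<phi>_plain add.commute)
qed

text \<open>The pentagon inequality holds on each frame, as disjoint sides give
  \<open>N = 1\<close>. The deviations are small only after summation over the frames.\<close>

lemma pentagon_bound:
  assumes zero: "\<And>L M. L \<in> labelings n \<Longrightarrow> M \<in> odd_matchings n
    \<Longrightarrow> card (M \<inter> label_edges n L) = 1 \<Longrightarrow> u L * v M = 0"
  shows "(\<Sum>i<5. \<Sum>h\<in>H. F h (Some i) * G h (Some i))
    \<le> 2 * (\<Sum>h\<in>H. F h None * G h None)
      + (\<Sum>i<5. \<epsilon> * (\<Sum>h\<in>H. (F h None + F h (Some i)) * G h (Some i))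
            + \<epsilon> * (\<Sum>h\<in>H. F h (Some i) * (G h None + G h (Some i))))
      + 5 * (tail p + tail q)"
proof -
  have "(\<Sum>i<5. F h (Some i) * G h (Some i)) \<le> 2 * (F h None * G h None)
      + (\<Sum>i<5. \<bar>F h (Some i) - F h None\<bar> * G h (Some i)
              + F h (Some i) * \<bar>G h (Some i) - G h None\<bar>)" if h: "h \<in> H" for h
  proof (rule sum_pentagon_le)
    show "0 \<le> F h None" "0 \<le> G h None"
      using F_bounds[OF h, of None] G_bounds[OF h, of None] by auto
    show "0 \<le> F h (Some i)" "0 \<le> G h (Some i)" if "i < 5" for i
      using F_bounds[OF h, of "Some i"] G_bounds[OF h, of "Some i"] that by auto
    show "F h (Some i) * G h (Some j) = 0"
      if "i < 5" "j < 5" "{i, nxt i} \<inter> {j, nxt j} = {}" for i j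
    proof -
      have "u (placed_labels n h (Some i) z) * v (placed_matching n h (Some j) t) = 0" for z t
      proof (intro zero placed_labels_in_labelings[OF h n] placed_matching_in_odd_matchings[OF h n])
        have "card (placed_matching n h (Some j) t \<inter> label_edges n (placed_labels n h (Some i) z))
            = card (violations (Some i) (Some j))"
          using that by (intro card_placed_matching_label_edges[OF h]) auto
        then show "card (placed_matching n h (Some j) t \<inter> label_edges n (placed_labels n h (Some i) z)) = 1"
          by (simp only: card_violations_disjoint[OF that])
      qed (use that in auto)
      then show ?thesis
        unfolding label_weight_def matching_weight_def sum_product
        by (intro sum.neutral ballI)
    qed
  qed
  then have "(\<Sum>h\<in>H. \<Sum>i<5. F h (Some i) * G h (Some i)) \<le> (\<Sum>h\<in>H. 2 * (F h None * G h None)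
      + (\<Sum>i<5. \<bar>F h (Some i) - F h None\<bar> * G h (Some i)
              + F h (Some i) * \<bar>G h (Some i) - G h None\<bar>))"
    by (rule sum_mono)
  also have "\<dots> = 2 * (\<Sum>h\<in>H. F h None * G h None)
      + (\<Sum>i<5. (\<Sum>h\<in>H. \<bar>F h (Some i) - F h None\<bar> * G h (Some i))
              + (\<Sum>h\<in>H. F h (Some i) * \<bar>G h (Some i) - G h None\<bar>))"
    by (simp add: sum.distrib sum_distrib_left sum.swap[of _ "{..<5}" H])
  also have "\<dots> \<le> 2 * (\<Sum>h\<in>H. F h None * G h None)
      + (\<Sum>i<5. (\<epsilon> * (\<Sum>h\<in>H. (F h None + F h (Some i)) * G h (Some i)) + tail p)
            + (\<epsilon> * (\<Sum>h\<in>H. F h (Some i) * (G h None + G h (Some i))) + tail q))"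
    using label_deviation matching_deviation by (intro add_mono sum_mono) auto
  also have "\<dots> = 2 * (\<Sum>h\<in>H. F h None * G h None)
      + (\<Sum>i<5. \<epsilon> * (\<Sum>h\<in>H. (F h None + F h (Some i)) * G h (Some i))
            + \<epsilon> * (\<Sum>h\<in>H. F h (Some i) * (G h None + G h (Some i))))
      + 5 * (tail p + tail q)"
    by (simp add: sum.distrib)
  finally show ?thesis
    by (subst (1) sum.swap)
qed

end

section \<open>Lower bound for the non-negative rank\<close>

lemma slack_factorization_bound:
  fixes a :: "nat \<Rightarrow> (vertex \<Rightarrow> nat) \<Rightarrow> real" and b :: "nat \<Rightarrow> edge set \<Rightarrow> real"
  assumes n: "n = 6 + p + 2 * q" and "q \<le> p"
    and a: "\<And>k L. k < r \<Longrightarrow> L \<in> labelings n \<Longrightarrow> 0 \<le> a k L"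
    and b: "\<And>k M. k < r \<Longrightarrow> M \<in> odd_matchings n \<Longrightarrow> 0 \<le> b k M"
    and eq: "\<And>L M. L \<in> labelings n \<Longrightarrow> M \<in> odd_matchings n
      \<Longrightarrow> real (card (M \<inter> label_edges n L)) - 1 = (\<Sum>k<r. a k L * b k M)"
  shows "1 \<le> 20 * real n * real r * exp (- (real (Suc q) / 6400))"
proof -
  \<comment> \<open>The deviations will add up to \<open>40 * \<epsilon> * S\<close>, which this
    choice makes \<open>S\<close>, half of the gap between \<open>10 * S\<close> and
    \<open>8 * S\<close>. The rate becomes \<open>\<epsilon>^2 / 4 = 1 / 6400\<close>.\<close>
  define \<epsilon> :: real where "\<epsilon> = 1 / 40"
  define \<alpha> where "\<alpha> k = Max (a k ` labelings n)" for k
  define \<beta> where "\<beta> k = Max (b k ` odd_matchings n)" for k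
  define H where "H = frames n p q"
  define S where "S = real (card H) * 2 ^ (p + q)"
  define E where "E = exp (- (real (Suc q) / 6400))"
  \<comment> \<open>The total of term \<open>k\<close> over the \<open>S\<close> choices of frame,
    \<open>z\<close> and \<open>t\<close> in configuration \<open>(c, e)\<close>.\<close>
  define A where "A k c e = (\<Sum>h\<in>H. label_weight (a k) n p h c * matching_weight (b k) n q h e)" for k c e
  obtain h0 where h0: "h0 \<in> H"
    using frames_nonempty[OF n] unfolding H_def by blast
  have "card H > 0"
    using h0 finite_frames[of n p q] by (auto simp: H_def card_gt_0_iff)
  then have "S > 0"
    by (simp add: S_def)
  have ne: "labelings n \<noteq> {}" "odd_matchings n \<noteq> {}"
    using placed_labels_in_labelings[of h0 n p q None] placed_matching_in_odd_matchings[of h0 n p q None] h0 n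
    unfolding H_def by force+
  \<comment> \<open>Both maxima are attained, so their product is one summand of a slack, and slacks
    are at most \<open>n\<close>.\<close>
  have \<alpha>\<beta>: "\<alpha> k * \<beta> k \<le> n" "0 \<le> \<alpha> k" "0 \<le> \<beta> k" if "k < r" for k
  proof -
    obtain L where L: "L \<in> labelings n" "\<alpha> k = a k L"
      using Max_in[of "a k ` labelings n"] ne finite_labelings unfolding \<alpha>_def by blast
    obtain M where M: "M \<in> odd_matchings n" "\<beta> k = b k M"
      using Max_in[of "b k ` odd_matchings n"] ne finite_odd_matchings unfolding \<beta>_def by blast
    show "0 \<le> \<alpha> k" "0 \<le> \<beta> k"
      using a b that L M by auto
    have "\<alpha> k * \<beta> k \<le> (\<Sum>k<r. a k L * b k M)"
      unfolding L(2) M(2) using a b L M that by (intro member_le_sum) auto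
    also have "\<dots> \<le> real (card (M \<inter> label_edges n L))"
      using eq[OF L(1) M(1)] by simp
    also have "\<dots> \<le> card M"
      using M(1) by (auto simp: odd_matchings_def intro!: card_mono perfect_matching_finite)
    also have "\<dots> = n"
      using M(1) by (simp add: odd_matchings_def card_perfect_matching)
    finally show "\<alpha> k * \<beta> k \<le> n" .
  qed
  have tail: "2 * real (card H) * 2 ^ (p + q) * \<alpha> k * \<beta> k * exp (- (\<epsilon>\<^sup>2 / 4 * Suc m)) \<le> 2 * S * n * E"
    if "k < r" "q \<le> m" for k m
  proof -
    have "exp (- (\<epsilon>\<^sup>2 / 4 * Suc m)) \<le> E"
      using that(2) by (simp add: E_def \<epsilon>_def power2_eq_square)
    then have "(\<alpha> k * \<beta> k) * exp (- (\<epsilon>\<^sup>2 / 4 * Suc m)) \<le> n * E"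
      using \<alpha>\<beta>[OF that(1)] by (intro mult_mono) auto
    then have "2 * S * ((\<alpha> k * \<beta> k) * exp (- (\<epsilon>\<^sup>2 / 4 * Suc m))) \<le> 2 * S * (n * E)"
      using \<open>S > 0\<close> by (intro mult_left_mono) auto
    then show ?thesis
      by (simp add: S_def mult.assoc)
  qed
  have pentagon: "(\<Sum>i<5. A k (Some i) (Some i)) \<le> 2 * A k None None
      + (\<Sum>i<5. \<epsilon> * (A k None (Some i) + A k (Some i) (Some i))
             + \<epsilon> * (A k (Some i) None + A k (Some i) (Some i))) + 20 * S * n * E"
    if k: "k < r" for k
  proof -
    interpret rank_one n p q "a k" "b k" "\<alpha> k" "\<beta> k" \<epsilon>
    proof
      show "0 \<le> a k L \<and> a k L \<le> \<alpha> k" if "L \<in> labelings n" for L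
        using a[OF k that] that finite_labelings by (auto simp: \<alpha>_def)
      show "0 \<le> b k M \<and> b k M \<le> \<beta> k" if "M \<in> odd_matchings n" for M
        using b[OF k that] that finite_odd_matchings by (auto simp: \<beta>_def)
    qed (use n in \<open>auto simp: \<epsilon>_def\<close>)
    have "(\<Sum>i<5. A k (Some i) (Some i)) \<le> 2 * A k None None
      + (\<Sum>i<5. \<epsilon> * (A k None (Some i) + A k (Some i) (Some i))
             + \<epsilon> * (A k (Some i) None + A k (Some i) (Some i)))
      + 5 * (tail p + tail q)"
      unfolding A_def H_def sum.distrib[symmetric] distrib_right[symmetric] distrib_left[symmetric]
    proof (rule pentagon_bound[unfolded distrib_left[symmetric] sum.distrib[symmetric]])
      fix L M assume LM: "L \<in> labelings n" "M \<in> odd_matchings n" "card (M \<inter> label_edges n L) = 1"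
      \<comment> \<open>The slack is 0, and a sum of non-negative terms vanishes only
        termwise.\<close>
      then have "(\<Sum>k<r. a k L * b k M) = 0"
        using eq[OF LM(1,2)] by simp
      then show "a k L * b k M = 0"
        using a b LM k by (subst (asm) sum_nonneg_eq_0_iff) auto
    qed
    also have "5 * (tail p + tail q) \<le> 5 * (2 * S * n * E + 2 * S * n * E)"
      using tail[OF k] \<open>q \<le> p\<close> unfolding H_def by (intro mult_left_mono add_mono) auto
    finally show ?thesis
      by (simp add: mult_ac)
  qed
  have total: "(\<Sum>k<r. A k c e) = S * (real (card (violations c e)) - 1)"
    if "\<And>i. c = Some i \<Longrightarrow> i < 5" "\<And>i. e = Some i \<Longrightarrow> i < 5" for c e
  proof -
    have "(\<Sum>k<r. A k c e) = (\<Sum>h\<in>H. \<Sum>z\<in>Pow {..<p}. \<Sum>t\<in>Pow {..<q}. \<Sum>k<r.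
        a k (placed_labels n h c z) * b k (placed_matching n h e t))"
      unfolding A_def label_weight_def matching_weight_def sum_product
      by (simp add: sum.swap[of _ _ "{..<r}"])
    also have "\<dots> = (\<Sum>h\<in>H. \<Sum>z\<in>Pow {..<p}. \<Sum>t\<in>Pow {..<q}. real (card (violations c e)) - 1)"
    proof (intro sum.cong refl)
      fix h z t assume "h \<in> H"
      then have h: "h \<in> frames n p q" by (simp add: H_def)
      show "(\<Sum>k<r. a k (placed_labels n h c z) * b k (placed_matching n h e t)) = real (card (violations c e)) - 1"
        using eq[OF placed_labels_in_labelings[OF h n that(1)] placed_matching_in_odd_matchings[OF h n that(2)]]
        by (simp add: card_placed_matching_label_edges[OF h that(2)])
    qed
    also have "\<dots> = S * (real (card (violations c e)) - 1)"
      by (simp add: S_def card_Pow power_add)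
    finally show ?thesis .
  qed
  have totals: "(\<Sum>k<r. A k None None) = 4 * S"
    "i < 5 \<Longrightarrow> (\<Sum>k<r. A k None (Some i)) = 2 * S"
    "i < 5 \<Longrightarrow> (\<Sum>k<r. A k (Some i) None) = 2 * S"
    "i < 5 \<Longrightarrow> (\<Sum>k<r. A k (Some i) (Some i)) = 2 * S" for i
    using total[of None None] total[of None "Some i"] total[of "Some i" None]
      total[of "Some i" "Some i"] card_violations_simps by auto
  have "(\<Sum>i<5. \<Sum>k<r. A k (Some i) (Some i)) = (\<Sum>k<r. \<Sum>i<5. A k (Some i) (Some i))"
    by (rule sum.swap)
  also have "\<dots> \<le> (\<Sum>k<r. 2 * A k None None
      + (\<Sum>i<5. \<epsilon> * (A k None (Some i) + A k (Some i) (Some i))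
             + \<epsilon> * (A k (Some i) None + A k (Some i) (Some i))) + 20 * S * n * E)"
    using pentagon by (intro sum_mono) auto
  also have "\<dots> = 2 * (\<Sum>k<r. A k None None)
      + (\<Sum>i<5. \<epsilon> * ((\<Sum>k<r. A k None (Some i)) + (\<Sum>k<r. A k (Some i) (Some i)))
             + \<epsilon> * ((\<Sum>k<r. A k (Some i) None) + (\<Sum>k<r. A k (Some i) (Some i))))
      + r * (20 * S * n * E)"
    by (simp add: sum.distrib sum_distrib_left distrib_left sum.swap[of _ "{..<5}" "{..<r}"])
  \<comment> \<open>\<open>2 * 4 * S\<close> from the initial configuration, and \<open>S\<close>
    from the deviations.\<close>
  also have "\<dots> = 9 * S + r * (20 * S * n * E)"
    by (simp add: totals \<epsilon>_def)
  finally have "10 * S \<le> 9 * S + r * (20 * S * n * E)"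
    by (simp add: totals)
  then have "S * 1 \<le> S * (20 * real n * real r * E)"
    by (simp add: algebra_simps)
  then show ?thesis
    using \<open>S > 0\<close> unfolding E_def by (simp only: mult_le_cancel_left_pos)
qed

text \<open>Provides a non-zero slack for every \<open>n > 0\<close>, including those too small for
  the main bound. Positions are the indices themselves, and only the edge at 0 is red.\<close>

lemma odd_matching_exists:
  assumes "n > 0"
  shows "\<exists>M \<in> odd_matchings n. (Inl 0, Inr 0, Red) \<in> M"
proof -
  let ?M = "matching n id id id (\<lambda>k :: nat. k \<noteq> 0)"
  have bij: "bij_betw id {..<n} {..<n}" by simp
  have "{k \<in> {..<n}. \<not> k \<noteq> 0} = {0}"
    using assms by auto
  then have "card {(u, v, c) \<in> ?M. c = Red} = 1"
    by (simp only: card_red_matching[OF bij bij bij]) simp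
  then have "?M \<in> odd_matchings n"
    using perfect_matching_matching[OF bij bij bij] by (simp add: odd_matchings_def)
  moreover have "(Inl 0, Inr 0, Red) \<in> ?M"
    using assms by (auto simp: matching_def)
  ultimately show ?thesis by blast
qed

theorem theorem3p2:
  fixes X :: "nat \<Rightarrow> (edge \<Rightarrow>\<^sub>0 real) set"
  assumes "\<And>n. n > 0 \<Longrightarrow> finite (X n)"
    and "\<And>n. n > 0 \<Longrightarrow> convex hull (X n) = odd_red_polytope n"
  shows "\<exists>f \<in> \<Omega>(\<lambda>n. real n). \<forall>n>0.
           real (nonneg_rank (X n) (constraint_system n) slack) = 2 powr f n"
proof -
  define r where "r n = nonneg_rank (X n) (constraint_system n) slack" for n
  have vertex: "char_vec M \<in> X n" if "n > 0" "M \<in> odd_matchings n" for n M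
    using char_vec_in_generators[OF assms(2)] that by (simp add: odd_matchings_def)
  have nonneg: "0 \<le> slack x C" if "n > 0" "x \<in> X n" "C \<in> constraint_system n" for n x C
    using that hull_inc[of x "X n" convex] assms(2)[of n] by (intro slack_nonneg) auto
  have fact: "has_nonneg_factorization (X n) (constraint_system n) slack (r n)" if "n > 0" for n
    unfolding r_def using assms(1) nonneg that by (intro nonneg_rank_factorization) auto
  \<comment> \<open>A power of two is positive, so rank 0 has to be excluded for each
    \<open>n\<close>.\<close>
  have pos: "r n > 0" if n: "n > 0" for n
  proof (rule ccontr)
    assume "\<not> r n > 0"
    then have zero: "slack x C = 0" if "x \<in> X n" "C \<in> constraint_system n" for x C
      using fact[OF n] that by (auto simp: has_nonneg_factorization_def)
    obtain M where M: "M \<in> odd_matchings n" "(Inl 0, Inr 0, Red) \<in> M"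
      using odd_matching_exists[OF n] by blast
    let ?e = "(Inl 0, Inr 0, Red)"
    have fin: "finite M"
      using M by (auto simp: odd_matchings_def intro: perfect_matching_finite)
    have "?e \<in> edges n"
      using M by (auto simp: odd_matchings_def perfect_matching_def)
    then have "Ge (char_vec {?e}) 0 \<in> constraint_system n"
      by (auto simp: constraint_system_def)
    moreover have "slack (char_vec M) (Ge (char_vec {?e}) 0) = 1"
      using M fin by (simp add: lin_form_uminus lin_form_char_vec)
    ultimately show False
      using zero[OF vertex[OF n M(1)]] by force
  qed
  have bound: "1 \<le> 20 * real n * real (r n) * exp (- ((real n - 6) / 19200))" if "n \<ge> 6" for n
  proof -
    \<comment> \<open>The largest \<open>q\<close> with \<open>q \<le> p\<close>, so that
      \<open>q\<close> is about \<open>n / 3\<close>; the rate becomes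
      \<open>1 / (3 * 6400) = 1 / 19200\<close>.\<close>
    define q where "q = (n - 6) div 3"
    define p where "p = n - 6 - 2 * q"
    have n: "n = 6 + p + 2 * q" "q \<le> p" "n > 0"
      using that unfolding p_def q_def by linarith+
    have "n \<le> 3 * Suc q + 6"
      unfolding q_def by presburger
    then have q: "real n - 6 \<le> 3 * real (Suc q)"
      by linarith
    obtain u v where
        sign: "\<forall>k<r n. (\<forall>x\<in>X n. 0 \<le> u k x) \<and> (\<forall>C\<in>constraint_system n. 0 \<le> v k C)"
        and eq: "\<forall>x\<in>X n. \<forall>C\<in>constraint_system n. slack x C = (\<Sum>k<r n. u k x * v k C)"
      using fact[OF n(3)] unfolding has_nonneg_factorization_def by (elim exE conjE)
    let ?C = "\<lambda>L. Ge (char_vec (label_edges n L)) 1"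
    have C: "?C L \<in> constraint_system n" if "L \<in> labelings n" for L
      using that by (auto simp: constraint_system_def)
    have "1 \<le> 20 * real n * real (r n) * exp (- (real (Suc q) / 6400))"
    \<comment> \<open>Only the submatrix of matchings and labeling constraints is used. Its row
      factors \<open>u\<close> belong to points, hence the exchange of the two factors.\<close>
    proof (rule slack_factorization_bound[OF n(1,2),
          where a = "\<lambda>k L. v k (?C L)" and b = "\<lambda>k M. u k (char_vec M)"])
      fix L M assume LM: "L \<in> labelings n" "M \<in> odd_matchings n"
      then have "finite M"
        by (auto simp: odd_matchings_def intro: perfect_matching_finite)
      then show "real (card (M \<inter> label_edges n L)) - 1 = (\<Sum>k<r n. v k (?C L) * u k (char_vec M))"
        using eq[rule_format, OF vertex[OF n(3) LM(2)] C[OF LM(1)]] slack_label_edges[of M n L]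
        by (simp only: mult.commute)
    qed (use sign vertex[OF n(3)] C in blast)+
    also have "\<dots> \<le> 20 * real n * real (r n) * exp (- ((real n - 6) / 19200))"
      using q by (intro mult_left_mono) auto
    finally show ?thesis .
  qed
  define f where "f n = log 2 (real (r n))" for n
  \<comment> \<open>Any constant below \<open>1 / 19200\<close> leaves room for the logarithm of the
    factor \<open>20 * n\<close>.\<close>
  have lower: "real n / 40000 \<le> f n"
    if n: "n \<ge> 6" "real n / 40000 \<le> (real n - 6) / 19200 - ln (20 * real n)" for n
  proof -
    have "r n > 0" "n > 0"
      using n pos[of n] by auto
    have "0 \<le> ln (20 * real n * real (r n) * exp (- ((real n - 6) / 19200)))"
      using bound[OF n(1)] by (rule ln_ge_zero)
    also have "\<dots> = ln (20 * real n) + ln (real (r n)) - (real n - 6) / 19200"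
      using \<open>r n > 0\<close> \<open>n > 0\<close> by (simp add: ln_mult)
    finally have "real n / 40000 \<le> ln (real (r n))"
      using n(2) by linarith
    also have "\<dots> \<le> ln (real (r n)) / ln 2"
      using \<open>r n > 0\<close> ln_2_less_1 by (simp add: field_simps mult_left_le)
    finally show ?thesis
      by (simp add: f_def log_def)
  qed
  have "eventually (\<lambda>n. real n / 40000 \<le> (real n - 6) / 19200 - ln (20 * real n)) at_top"
    by real_asymp
  then have "eventually (\<lambda>n. (1 / 40000) * norm (real n) \<le> norm (f n)) at_top"
    using eventually_ge_at_top[of 6] by eventually_elim (use lower in force)
  then have "f \<in> \<Omega>(\<lambda>n. real n)"
    by (intro landau_omega.bigI[of "1 / 40000"]) auto
  moreover have "real (r n) = 2 powr f n" if "n > 0" for n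
    using pos[OF that] by (simp add: f_def)
  ultimately show ?thesis
    unfolding r_def by blast
qed

end
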